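(* Fix $H\in\{2,-2\}$ and let $F(z,\bar z)$ be a smooth map from a domain in $\mathbb{C}$ to the twisted loop group $\Lambda^{\sigma,\tau}_{\mathbb{C}^\times}\mathrm{SL}(3,\mathbb{C})$. If $F^{-1}F_z$ is linear in the loop parameter $\lambda$, i.e. of the form $F^{-1}F_z=\lambda A+B$ with $A=A(z,\bar z)$, $B=B(z,\bar z)$ independent of $\lambda$, and the entry $A_{13}$ is nowhere zero, then $F^{-1}\,dF$ is gauge equivalent to the Maurer-Cartan form $\alpha_\lambda$ of proper definite affine spheres for some solution $(\psi,U)$ of the Gauss-Codazzi equations. In other words, $F$ is gauge equivalent to the extended frame of a proper definite affine sphere if and only if $[F]$ defines a primitive harmonic map into the $6$-symmetric space "$\mathrm{SL}(3,\mathbb{R})$"$/\mathrm{SO}(2,\mathbb{R})$ satisfying the nondegeneracy condition.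
   Context: Put $\epsilon=e^{\pi i/3}$, and let $$T=\begin{pmatrix}0&1&0\\1&0&0\\0&0&-H/2\end{pmatrix},\qquad P=\begin{pmatrix}0&\epsilon^4&0\\ \epsilon^2&0&0\\0&0&1\end{pmatrix}.$$ $H=-2$ is the hyperbolic case and $H=2$ the elliptic case. On $\mathrm{SL}(3,\mathbb{C})$ put $\tau(g)=T\bar gT^{-1}$ and $\sigma(g)=P(g^t)^{-1}P^{-1}$. $\Lambda^{\sigma,\tau}_{\mathbb{C}^\times}\mathrm{SL}(3,\mathbb{C})$ is the group of holomorphic maps $g:\mathbb{C}^\times=\mathbb{C}\setminus\{0\}\to \mathrm{SL}(3,\mathbb{C})$ with $\tau(g(\bar\lambda^{-1}))=g(\lambda)$ and $\sigma(g(\lambda))=g(\epsilon\lambda)$. The map $F=F(z,\bar z,\lambda)$ is smooth jointly in $z$ and $\lambda$. Let $s=\sqrt{-H/2}$, i.e. $s=1$ if $H=-2$ and $s=i$ if $H=2$. For a real function $\psi$ and a complex function $U$, the Maurer-Cartan form is $$\alpha_\lambda=\begin{pmatrix}\frac12(\psi_z dz-\psi_{\bar z}d\bar z)&\lambda^{-1}\bar Ue^{-\psi}d\bar z& s\lambda e^{\psi/2}dz\\ \lambda Ue^{-\psi}dz&\frac12(\psi_{\bar z}d\bar z-\psi_zdz)& s\lambda^{-1}e^{\psi/2}d\bar z\\ s\lambda^{-1}e^{\psi/2}d\bar z& s\lambda e^{\psi/2}dz&0\end{pmatrix}.$$ The Gauss-Codazzi equations of a definite affine sphere in $\mathbb{R}^3$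 with affine metric $e^\psi|dz|^2$, affine cubic form $U\,dz^3+\bar U\,d\bar z^3$ and constant affine mean curvature $H$ are $$\psi_{z\bar z}+\tfrac H2e^{\psi}+|U|^2e^{-2\psi}=0,\qquad U_{\bar z}=0.$$ An extended frame of a proper definite affine sphere is a map $F=F(z,\bar z,\lambda)$, smooth jointly in $z$ and $\lambda$, from a domain in $\mathbb{C}$ to $\Lambda^{\sigma,\tau}_{\mathbb{C}^\times}\mathrm{SL}(3,\mathbb{C})$ with $F^{-1}dF=\alpha_\lambda$ for some solution $(\psi,U)$ of the Gauss-Codazzi equations $\psi_{z\bar z}+\tfrac H2e^{\psi}+|U|^2e^{-2\psi}=0$, $U_{\bar z}=0$. Gauge equivalence: $F$ is replaced by $Fk$ (so $F^{-1}dF$ is replaced by $(Fk)^{-1}d(Fk)$), where $k=\mathrm{diag}(e^{i\beta},e^{-i\beta},1)$ for a smooth map $e^{i\beta}$ from the domain to the unit circle; such $k$ take values in the group of elements independent of $\lambda$ fixed by $\sigma$ and $\tau$, identified with $\mathrm{SO}(2,\mathbb{R})$. "$\mathrm{SL}(3,\mathbb{R})$" denotes the fixed point group of $\tau$. Saying that $[F]$ ($F$ modulo this gauge group) defines a primitive harmonic map satisfying the nondegeneracy condition means that $F^{-1}F_z=\lambda A+B$ with $A,B$ independent of $\lambda$ and $A_{13}$ nowhere zero. *)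

theory Defs
  imports "HOL-Analysis.Analysis"
begin

(* Real C^n and C^\<infinity> regularity; the intended use is on open sets S. *)
primrec Cn_on :: "nat \<Rightarrow> 'a::euclidean_space set \<Rightarrow> ('a \<Rightarrow> 'b::real_normed_vector) \<Rightarrow> bool" where
  "Cn_on 0 S f \<longleftrightarrow> continuous_on S f"
| "Cn_on (Suc n) S f \<longleftrightarrow>
     (\<forall>x\<in>S. f differentiable (at x)) \<and> (\<forall>v. Cn_on n S (\<lambda>x. frechet_derivative f (at x) v))"

definition smooth_on :: "'a::euclidean_space set \<Rightarrow> ('a \<Rightarrow> 'b::real_normed_vector) \<Rightarrow> bool" where
  "smooth_on S f \<longleftrightarrow> (\<forall>n. Cn_on n S f)"

definition is_domain :: "complex set \<Rightarrow> bool" where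
  "is_domain D \<longleftrightarrow> open D \<and> connected D \<and> D \<noteq> {}"

(* The Wirtinger derivatives (\<partial>_x - i \<partial>_y)/2 and (\<partial>_x + i \<partial>_y)/2. *)
definition d_z :: "(complex \<Rightarrow> complex) \<Rightarrow> complex \<Rightarrow> complex" where
  "d_z f z = (frechet_derivative f (at z) 1 - \<i> * frechet_derivative f (at z) \<i>) / 2"

definition d_zbar :: "(complex \<Rightarrow> complex) \<Rightarrow> complex \<Rightarrow> complex" where
  "d_zbar f z = (frechet_derivative f (at z) 1 + \<i> * frechet_derivative f (at z) \<i>) / 2"

type_synonym mat3 = "complex^3^3"

definition eps :: complex where
  "eps = exp (\<i> * of_real (pi / 3))"

definition T_mat :: "real \<Rightarrow> mat3" where
  "T_mat H = vector [vector [0, 1, 0],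
                     vector [1, 0, 0],
                     vector [0, 0, of_real (- H / 2)]]"

definition P_mat :: mat3 where
  "P_mat = vector [vector [0, eps ^ 4, 0],
                   vector [eps ^ 2, 0, 0],
                   vector [0, 0, 1]]"

definition tau :: "real \<Rightarrow> mat3 \<Rightarrow> mat3" where
  "tau H g = T_mat H ** map_matrix cnj g ** matrix_inv (T_mat H)"

definition sigma :: "mat3 \<Rightarrow> mat3" where
  "sigma g = P_mat ** matrix_inv (transpose g) ** matrix_inv P_mat"

(* Loops are total functions whose value at 0 is irrelevant. *)
definition twisted_loop_group :: "real \<Rightarrow> (complex \<Rightarrow> mat3) set" where
  "twisted_loop_group H =
     {g. (\<forall>l. l \<noteq> 0 \<longrightarrow> det (g l) = 1) \<and>
         (\<forall>i j. (\<lambda>l. g l $ i $ j) holomorphic_on (- {0})) \<and>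
         (\<forall>l. l \<noteq> 0 \<longrightarrow> tau H (g (inverse (cnj l))) = g l) \<and>
         (\<forall>l. l \<noteq> 0 \<longrightarrow> sigma (g l) = g (eps * l))}"

(* In F z l the arguments are the point z of the domain and the loop parameter l. *)
definition smooth_loop_map :: "real \<Rightarrow> complex set \<Rightarrow> (complex \<Rightarrow> complex \<Rightarrow> mat3) \<Rightarrow> bool" where
  "smooth_loop_map H D F \<longleftrightarrow>
     (\<forall>z\<in>D. F z \<in> twisted_loop_group H) \<and> smooth_on (D \<times> (- {0})) (\<lambda>(z, l). F z l)"

(* The matrix-valued 1-form F^{-1} dF (d in z only) at the point z, applied to the tangent
   vector v. *)
definition mc_form :: "(complex \<Rightarrow> complex \<Rightarrow> mat3) \<Rightarrow> complex \<Rightarrow> complex \<Rightarrow> complex \<Rightarrow> mat3" where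
  "mc_form F l z v = matrix_inv (F z l) ** frechet_derivative (\<lambda>w. F w l) (at z) v"

(* F^{-1} F_z *)
definition mc_z :: "(complex \<Rightarrow> complex \<Rightarrow> mat3) \<Rightarrow> complex \<Rightarrow> complex \<Rightarrow> mat3" where
  "mc_z F l z = matrix_inv (F z l) ** (\<chi> i j. d_z (\<lambda>w. F w l $ i $ j) z)"

definition s_const :: "real \<Rightarrow> complex" where
  "s_const H = csqrt (of_real (- H / 2))"

(* The 1-form \<alpha>_\<lambda> at z applied to the tangent vector v, i.e. with dz = v, d\<bar>z = cnj v. *)
definition alpha ::
  "real \<Rightarrow> (complex \<Rightarrow> real) \<Rightarrow> (complex \<Rightarrow> complex) \<Rightarrow> complex \<Rightarrow> complex \<Rightarrow> complex \<Rightarrow> mat3" where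
  "alpha H psi U l z v =
     (let dz = v; dzb = cnj v; s = s_const H;
          psi_z = d_z (\<lambda>w. of_real (psi w)) z;
          psi_zb = d_zbar (\<lambda>w. of_real (psi w)) z;
          e = complex_of_real (exp (psi z / 2));
          em = complex_of_real (exp (- psi z))
      in vector
        [vector [(psi_z * dz - psi_zb * dzb) / 2, inverse l * cnj (U z) * em * dzb, s * l * e * dz],
         vector [l * U z * em * dz, (psi_zb * dzb - psi_z * dz) / 2, s * inverse l * e * dzb],
         vector [s * inverse l * e * dzb, s * l * e * dz, 0]])"

definition gauss_codazzi ::
  "real \<Rightarrow> complex set \<Rightarrow> (complex \<Rightarrow> real) \<Rightarrow> (complex \<Rightarrow> complex) \<Rightarrow> bool" where
  "gauss_codazzi H D psi U \<longleftrightarrow>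
     smooth_on D psi \<and> smooth_on D U \<and>
     (\<forall>z\<in>D. d_zbar (d_z (\<lambda>w. of_real (psi w))) z + of_real (H / 2 * exp (psi z))
              + of_real ((cmod (U z))\<^sup>2 * exp (- 2 * psi z)) = 0) \<and>
     (\<forall>z\<in>D. d_zbar U z = 0)"

definition extended_frame :: "real \<Rightarrow> complex set \<Rightarrow> (complex \<Rightarrow> complex \<Rightarrow> mat3) \<Rightarrow> bool" where
  "extended_frame H D F \<longleftrightarrow>
     smooth_loop_map H D F \<and>
     (\<exists>psi U. gauss_codazzi H D psi U \<and>
        (\<forall>z\<in>D. \<forall>l. l \<noteq> 0 \<longrightarrow> (\<forall>v. mc_form F l z v = alpha H psi U l z v)))"

(* The parameter u stands for e^{i\<beta>}; \<beta> itself need not exist globally on the domain. *)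
definition is_gauge :: "complex set \<Rightarrow> (complex \<Rightarrow> complex) \<Rightarrow> bool" where
  "is_gauge D u \<longleftrightarrow> smooth_on D u \<and> (\<forall>z\<in>D. norm (u z) = 1)"

definition gauge_mat :: "complex \<Rightarrow> mat3" where
  "gauge_mat c = vector [vector [c, 0, 0], vector [0, inverse c, 0], vector [0, 0, 1]]"

definition gauged ::
  "(complex \<Rightarrow> complex \<Rightarrow> mat3) \<Rightarrow> (complex \<Rightarrow> complex) \<Rightarrow> complex \<Rightarrow> complex \<Rightarrow> mat3" where
  "gauged F u z l = F z l ** gauge_mat (u z)"

definition linear_in_loop_parameter ::
  "complex set \<Rightarrow> (complex \<Rightarrow> complex \<Rightarrow> mat3) \<Rightarrow> (complex \<Rightarrow> mat3) \<Rightarrow> (complex \<Rightarrow> mat3) \<Rightarrow> bool" where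
  "linear_in_loop_parameter D F A B \<longleftrightarrow>
     (\<forall>z\<in>D. \<forall>l. l \<noteq> 0 \<longrightarrow> mc_z F l z = map_matrix ((*) l) (A z) + B z)"

definition primitive_harmonic_nondegenerate ::
  "complex set \<Rightarrow> (complex \<Rightarrow> complex \<Rightarrow> mat3) \<Rightarrow> bool" where
  "primitive_harmonic_nondegenerate D F \<longleftrightarrow>
     (\<exists>A B. linear_in_loop_parameter D F A B \<and> (\<forall>z\<in>D. A z $ 1 $ 3 \<noteq> 0))"

end

theory Submission
  imports Defs
begin

text \<open>
  Write \<open>M = F\<^sup>-\<^sup>1F\<^sub>z\<close>. Differentiating the \<open>\<sigma>\<close>-condition in the form \<open>F(\<epsilon>\<lambda>) P F(\<lambda>)\<^sup>T = P\<close> gives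
  \<open>M(\<epsilon>\<lambda>) P + P M(\<lambda>)\<^sup>T = 0\<close>. For \<open>M = \<lambda>A + B\<close> this leaves only \<open>A\<^sub>1\<^sub>3 = A\<^sub>3\<^sub>2 = a\<close>, \<open>A\<^sub>2\<^sub>1 = b\<close> and
  \<open>B = diag(c, -c, 0)\<close>, and the \<open>\<tau>\<close>-condition expresses the \<open>cnj z\<close>-part by the conjugates of \<open>a, b, c\<close>.
  Equality of the mixed second derivatives of \<open>F\<close>, read off at \<open>\<lambda> = 1\<close> in three entries, gives the
  structure equations for \<open>a, b, c\<close>. The gauge \<open>u = a / (s |a|)\<close> then makes the 13-entry positive up
  to the factor \<open>s\<close>; with \<open>e\<^sup>\<psi> = |a|\<^sup>2\<close> and \<open>U = -(H/2) a\<^sup>2b\<close> the structure equations become the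
  Gauss-Codazzi equations.\<close>

section \<open>Calculus of smooth maps\<close>

lemma Cn_on_cong:
  assumes "open S" "\<And>x. x \<in> S \<Longrightarrow> f x = g x" "Cn_on n S f"
  shows "Cn_on n S g"
  using assms(2,3)
proof (induction n arbitrary: f g)
  case 0
  then show ?case by (simp cong: continuous_on_cong)
next
  case (Suc n)
  have "g differentiable (at x)" if "x \<in> S" for x
    using Suc.prems that has_derivative_transform_within_open[OF _ assms(1) that]
    unfolding differentiable_def Cn_on.simps by blast
  moreover have "Cn_on n S (\<lambda>x. frechet_derivative g (at x) v)" for v
  proof (rule Suc.IH)
    show "Cn_on n S (\<lambda>x. frechet_derivative f (at x) v)" using Suc.prems by simp
    show "frechet_derivative f (at x) v = frechet_derivative g (at x) v" if "x \<in> S" for x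
      using frechet_derivative_transform_within_open[OF _ assms(1) that, of f g] Suc.prems that
      by simp
  qed
  ultimately show ?case by simp
qed

text \<open>\<open>frechet_derivative\<close> is given by choice, but derivatives are unique, so any
  explicit formula \<open>f'\<close> valid on the open set may replace it. The rules below for sums,
  products, compositions, inverses, \<open>exp\<close> and \<open>ln\<close> all go through this
  criterion.\<close>

lemma Cn_on_SucI:
  assumes "open S"
    and "\<And>x. x \<in> S \<Longrightarrow> (f has_derivative f' x) (at x)"
    and "\<And>v. Cn_on n S (\<lambda>x. f' x v)"
  shows "Cn_on (Suc n) S f"
proof -
  have "Cn_on n S (\<lambda>x. frechet_derivative f (at x) v)" for v
    by (rule Cn_on_cong[OF assms(1) _ assms(3)]) (simp add: frechet_derivative_at[OF assms(2)])
  then show ?thesis using assms(2) by (auto simp: differentiable_def)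
qed

lemma Cn_on_has_derivative:
  "Cn_on (Suc n) S f \<Longrightarrow> x \<in> S \<Longrightarrow> (f has_derivative frechet_derivative f (at x)) (at x)"
  by (simp add: frechet_derivative_works)

lemma Cn_on_SucD: "Cn_on (Suc n) S f \<Longrightarrow> Cn_on n S f"
proof (induction n arbitrary: f)
  case 0
  then show ?case
    by (auto intro!: continuous_at_imp_continuous_on differentiable_imp_continuous_within)
next
  case (Suc n)
  then show ?case by (metis Cn_on.simps(2))
qed

lemma Cn_on_const: "Cn_on n S (\<lambda>x. c)"
  by (induction n arbitrary: c) auto

lemma Cn_on_add:
  assumes "open S" "Cn_on n S f" "Cn_on n S g"
  shows "Cn_on n S (\<lambda>x. f x + g x)"
  using assms(2,3)
proof (induction n arbitrary: f g)
  case 0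
  then show ?case by (auto intro: continuous_intros)
next
  case (Suc n)
  show ?case
    by (rule Cn_on_SucI[OF assms(1)])
      (auto intro!: has_derivative_add Cn_on_has_derivative[OF Suc.prems(1)]
        Cn_on_has_derivative[OF Suc.prems(2)] Suc.IH, use Suc.prems in auto)
qed

lemma Cn_on_bounded_linear:
  assumes "open S" "bounded_linear L" "Cn_on n S f"
  shows "Cn_on n S (\<lambda>x. L (f x))"
  using assms(3)
proof (induction n arbitrary: f)
  case 0
  then show ?case using bounded_linear.continuous_on[OF assms(2)] by auto
next
  case (Suc n)
  show ?case
    by (rule Cn_on_SucI[OF assms(1)])
      (auto intro!: bounded_linear.has_derivative[OF assms(2)] Cn_on_has_derivative[OF Suc.prems]
        Suc.IH, use Suc.prems in auto)
qed

text \<open>The product rule gives two terms, each with one factor left undifferentiated;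
  \<open>Cn_on_SucD\<close> lowers the order of that factor, and the induction hypothesis for
  arbitrary pairs applies to both terms.\<close>

lemma Cn_on_bounded_bilinear:
  assumes "open S" "bounded_bilinear B" "Cn_on n S f" "Cn_on n S g"
  shows "Cn_on n S (\<lambda>x. B (f x) (g x))"
  using assms(3,4)
proof (induction n arbitrary: f g)
  case 0
  then show ?case using bounded_bilinear.continuous_on[OF assms(2)] by auto
next
  case (Suc n)
  show ?case
  proof (rule Cn_on_SucI[OF assms(1)])
    show "((\<lambda>x. B (f x) (g x)) has_derivative
        (\<lambda>v. B (f x) (frechet_derivative g (at x) v) + B (frechet_derivative f (at x) v) (g x))) (at x)"
      if "x \<in> S" for x
      using that by (intro bounded_bilinear.FDERIV[OF assms(2)] Cn_on_has_derivative[OF Suc.prems(1)]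
        Cn_on_has_derivative[OF Suc.prems(2)])
    show "Cn_on n S (\<lambda>x. B (f x) (frechet_derivative g (at x) v)
            + B (frechet_derivative f (at x) v) (g x))" for v
      using Suc.prems Cn_on_SucD[OF Suc.prems(1)] Cn_on_SucD[OF Suc.prems(2)]
      by (intro Cn_on_add[OF assms(1)] Suc.IH) auto
  qed
qed

text \<open>For an affine inner map the chain rule again produces a function of
  \<open>c + L x\<close>, so the induction closes. This serves to freeze the loop parameter in
  \<open>F\<close> and to pull a function of \<open>z\<close> back to pairs
  \<open>(z, l)\<close>.\<close>

lemma Cn_on_compose_affine:
  assumes "open S" "open S'" "bounded_linear L" "\<And>x. x \<in> S' \<Longrightarrow> c + L x \<in> S" "Cn_on n S f"
  shows "Cn_on n S' (\<lambda>x. f (c + L x))"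
  using assms(5)
proof (induction n arbitrary: f)
  case 0
  have "continuous_on S' (\<lambda>x. c + L x)"
    using bounded_linear.continuous_on[OF assms(3) continuous_on_id] by (auto intro: continuous_intros)
  then show ?case using 0 assms(4) by (auto intro: continuous_on_compose2)
next
  case (Suc n)
  show ?case
  proof (rule Cn_on_SucI[OF assms(2)])
    show "((\<lambda>x. f (c + L x)) has_derivative
        (\<lambda>v. frechet_derivative f (at (c + L x)) (L v))) (at x)" if "x \<in> S'" for x
    proof -
      have "((\<lambda>x. c + L x) has_derivative L) (at x)"
        using bounded_linear_imp_has_derivative[OF assms(3)] by (auto intro!: derivative_eq_intros)
      from has_derivative_compose[OF this Cn_on_has_derivative[OF Suc.prems assms(4)[OF that]]]
      show ?thesis .
    qed
    show "Cn_on n S' (\<lambda>x. frechet_derivative f (at (c + L x)) (L v))" for v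
      using Suc.prems by (intro Suc.IH) auto
  qed
qed

text \<open>The derivative is a polynomial in \<open>inverse f\<close> and the derivative of
  \<open>f\<close>, so the induction hypothesis concerns the same \<open>f\<close> one order
  lower.\<close>

lemma Cn_on_inverse:
  fixes f :: "'a::euclidean_space \<Rightarrow> 'b::real_normed_field"
  assumes "open S" "\<And>x. x \<in> S \<Longrightarrow> f x \<noteq> 0" "Cn_on n S f"
  shows "Cn_on n S (\<lambda>x. inverse (f x))"
  using assms(3)
proof (induction n)
  case 0
  then show ?case using assms(2) by (auto intro: continuous_intros)
next
  case (Suc n)
  have inv: "Cn_on n S (\<lambda>x. inverse (f x))" using Suc.IH Cn_on_SucD[OF Suc.prems] .
  show ?case
  proof (rule Cn_on_SucI[OF assms(1)])
    show "((\<lambda>x. inverse (f x)) has_derivative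
        (\<lambda>v. - (inverse (f x) * frechet_derivative f (at x) v * inverse (f x)))) (at x)"
      if "x \<in> S" for x
      using assms(2) that by (auto intro!: Deriv.has_derivative_inverse Cn_on_has_derivative[OF Suc.prems])
    show "Cn_on n S (\<lambda>x. - (inverse (f x) * frechet_derivative f (at x) v * inverse (f x)))" for v
      using Suc.prems inv
      by (intro Cn_on_bounded_linear[OF assms(1) bounded_linear_minus[OF bounded_linear_ident]]
          Cn_on_bounded_bilinear[OF assms(1) bounded_bilinear_mult]) auto
  qed
qed

lemma Cn_on_exp:
  fixes f :: "'a::euclidean_space \<Rightarrow> real"
  assumes "open S" "Cn_on n S f"
  shows "Cn_on n S (\<lambda>x. exp (f x))"
  using assms(2)
proof (induction n)
  case 0
  then show ?case by (auto intro: continuous_intros)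
next
  case (Suc n)
  show ?case
  proof (rule Cn_on_SucI[OF assms(1)])
    show "((\<lambda>x. exp (f x)) has_derivative
        (\<lambda>v. frechet_derivative f (at x) v * exp (f x))) (at x)"
      if "x \<in> S" for x
      using that by (intro has_derivative_exp Cn_on_has_derivative[OF Suc.prems]) auto
    show "Cn_on n S (\<lambda>x. frechet_derivative f (at x) v * exp (f x))" for v
      using Suc.prems Suc.IH Cn_on_SucD[OF Suc.prems]
      by (intro Cn_on_bounded_bilinear[OF assms(1) bounded_bilinear_mult]) auto
  qed
qed

text \<open>One differentiation turns the logarithm into a quotient, which
  \<open>Cn_on_inverse\<close> already covers; a case distinction on the order replaces the
  induction.\<close>

lemma Cn_on_ln:
  fixes f :: "'a::euclidean_space \<Rightarrow> real"
  assumes "open S" "\<And>x. x \<in> S \<Longrightarrow> f x > 0" "Cn_on n S f"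
  shows "Cn_on n S (\<lambda>x. ln (f x))"
proof (cases n)
  case 0
  then show ?thesis using assms by (auto intro!: continuous_intros) force
next
  case (Suc m)
  then have C: "Cn_on (Suc m) S f" using assms(3) by simp
  have "Cn_on (Suc m) S (\<lambda>x. ln (f x))"
  proof (rule Cn_on_SucI[OF assms(1)])
    show "((\<lambda>x. ln (f x)) has_derivative
        (\<lambda>v. frechet_derivative f (at x) v * inverse (f x))) (at x)"
      if "x \<in> S" for x
      using that assms(2)
      by (intro has_derivative_ln Cn_on_has_derivative[OF C]) auto
    show "Cn_on m S (\<lambda>x. frechet_derivative f (at x) v * inverse (f x))" for v
      using C assms(2) Cn_on_SucD[OF C]
      by (intro Cn_on_bounded_bilinear[OF assms(1) bounded_bilinear_mult]
          Cn_on_inverse[OF assms(1)]) (auto simp: less_imp_neq[symmetric])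
  qed
  then show ?thesis using Suc by simp
qed

section \<open>Closure properties of smooth maps\<close>

lemma smooth_on_cong:
  "open S \<Longrightarrow> smooth_on S f \<Longrightarrow> (\<And>x. x \<in> S \<Longrightarrow> f x = g x) \<Longrightarrow> smooth_on S g"
  unfolding smooth_on_def by (blast intro: Cn_on_cong)

lemma smooth_on_const: "smooth_on S (\<lambda>x. c)"
  by (simp add: smooth_on_def Cn_on_const)

lemma smooth_on_add: "open S \<Longrightarrow> smooth_on S f \<Longrightarrow> smooth_on S g \<Longrightarrow> smooth_on S (\<lambda>x. f x + g x)"
  by (simp add: smooth_on_def Cn_on_add)

lemma smooth_on_sum:
  "open S \<Longrightarrow> (\<And>i. i \<in> I \<Longrightarrow> smooth_on S (f i)) \<Longrightarrow> smooth_on S (\<lambda>x. \<Sum>i\<in>I. f i x)"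
  by (induction I rule: infinite_finite_induct) (simp_all add: smooth_on_const smooth_on_add)

lemma smooth_on_bounded_linear:
  "open S \<Longrightarrow> bounded_linear L \<Longrightarrow> smooth_on S f \<Longrightarrow> smooth_on S (\<lambda>x. L (f x))"
  by (simp add: smooth_on_def Cn_on_bounded_linear)

lemma smooth_on_mult:
  fixes f g :: "'a::euclidean_space \<Rightarrow> 'b::real_normed_algebra"
  shows "open S \<Longrightarrow> smooth_on S f \<Longrightarrow> smooth_on S g \<Longrightarrow> smooth_on S (\<lambda>x. f x * g x)"
  by (simp add: smooth_on_def Cn_on_bounded_bilinear[OF _ bounded_bilinear_mult])

lemma smooth_on_compose_affine:
  "open S \<Longrightarrow> open S' \<Longrightarrow> bounded_linear L \<Longrightarrow> (\<And>x. x \<in> S' \<Longrightarrow> c + L x \<in> S) \<Longrightarrow> smooth_on S f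
    \<Longrightarrow> smooth_on S' (\<lambda>x. f (c + L x))"
  by (simp add: smooth_on_def Cn_on_compose_affine)

lemma smooth_on_inverse:
  fixes f :: "'a::euclidean_space \<Rightarrow> 'b::real_normed_field"
  shows "open S \<Longrightarrow> (\<And>x. x \<in> S \<Longrightarrow> f x \<noteq> 0) \<Longrightarrow> smooth_on S f \<Longrightarrow> smooth_on S (\<lambda>x. inverse (f x))"
  by (simp add: smooth_on_def Cn_on_inverse)

lemma smooth_on_exp:
  fixes f :: "'a::euclidean_space \<Rightarrow> real"
  shows "open S \<Longrightarrow> smooth_on S f \<Longrightarrow> smooth_on S (\<lambda>x. exp (f x))"
  by (simp add: smooth_on_def Cn_on_exp)

lemma smooth_on_ln:
  fixes f :: "'a::euclidean_space \<Rightarrow> real"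
  shows "open S \<Longrightarrow> (\<And>x. x \<in> S \<Longrightarrow> f x > 0) \<Longrightarrow> smooth_on S f \<Longrightarrow> smooth_on S (\<lambda>x. ln (f x))"
  by (simp add: smooth_on_def Cn_on_ln)

lemma smooth_on_vec_nth: "open S \<Longrightarrow> smooth_on S f \<Longrightarrow> smooth_on S (\<lambda>x. f x $ i)"
  by (rule smooth_on_bounded_linear[OF _ bounded_linear_vec_nth])

text \<open>A vector is the finite sum of its components placed on the axes, and each axis embedding
  is bounded linear.\<close>

lemma smooth_on_vec_lambda:
  fixes f :: "'a::euclidean_space \<Rightarrow> 'b::real_normed_vector^'n"
  assumes "open S" "\<And>i. smooth_on S (\<lambda>x. f x $ i)"
  shows "smooth_on S f"
proof -
  have ax: "bounded_linear (\<lambda>y::'b. axis i y)" for i :: 'n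
  proof (rule bounded_linear_intro[where K=1])
    show "norm (axis i y) \<le> norm y * 1" for y :: 'b
    proof -
      have "(norm (axis i y $ j))\<^sup>2 = (if j = i then (norm y)\<^sup>2 else 0)" for j
        by (simp add: axis_def)
      then show ?thesis by (simp add: norm_vec_def L2_set_def)
    qed
  qed (simp_all add: vec_eq_iff axis_def)
  have "f x = (\<Sum>i\<in>UNIV. axis i (f x $ i))" for x
    by (simp add: vec_eq_iff axis_def if_distrib sum.delta cong: if_cong)
  moreover have "smooth_on S (\<lambda>x. \<Sum>i\<in>UNIV. axis i (f x $ i))"
    by (intro smooth_on_sum smooth_on_bounded_linear[OF _ ax] assms)
  ultimately show ?thesis by simp
qed

lemma smooth_on_frechet_derivative:
  "smooth_on S f \<Longrightarrow> smooth_on S (\<lambda>x. frechet_derivative f (at x) v)"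
  unfolding smooth_on_def by (metis Cn_on.simps(2))

lemma smooth_on_differentiable: "smooth_on S f \<Longrightarrow> x \<in> S \<Longrightarrow> f differentiable (at x)"
  unfolding smooth_on_def by (metis Cn_on.simps(2))

lemma smooth_on_continuous_on: "smooth_on S f \<Longrightarrow> continuous_on S f"
  unfolding smooth_on_def by (metis Cn_on.simps(1))

lemma frechet_derivative_bounded_linear:
  assumes "bounded_linear L" "f differentiable (at x)"
  shows "frechet_derivative (\<lambda>x. L (f x)) (at x) = (\<lambda>v. L (frechet_derivative f (at x) v))"
  using bounded_linear.has_derivative[OF assms(1)] assms(2)
  by (metis frechet_derivative_at frechet_derivative_works)

section \<open>Symmetry of second derivatives\<close>

lemma DERIV_along_line:
  fixes f :: "'a::real_normed_vector \<Rightarrow> real"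
  assumes "f differentiable (at (p + t *\<^sub>R v))"
  shows "((\<lambda>t. f (p + t *\<^sub>R v)) has_real_derivative frechet_derivative f (at (p + t *\<^sub>R v)) v) (at t)"
proof -
  have lin: "linear (frechet_derivative f (at (p + t *\<^sub>R v)))"
    using assms by (rule linear_frechet_derivative)
  have "((\<lambda>t. p + t *\<^sub>R v) has_derivative (\<lambda>h. h *\<^sub>R v)) (at t)"
    by (auto intro!: derivative_eq_intros)
  from has_derivative_compose[OF this assms[unfolded frechet_derivative_works]]
  show ?thesis
    unfolding has_field_derivative_def
    by (simp add: linear_scale[OF lin] mult_commute_abs)
qed

text \<open>The mean value theorem, applied in direction \<open>v\<close> to \<open>y \<mapsto> f (y + h w) - f y\<close> and then
  in direction \<open>w\<close> to the derivative along \<open>v\<close>.\<close>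
lemma second_difference_mean_value:
  fixes f :: "'a::euclidean_space \<Rightarrow> real"
  assumes f: "smooth_on S f" and h: "0 < h"
    and S: "\<And>s t. 0 \<le> s \<Longrightarrow> s \<le> h \<Longrightarrow> 0 \<le> t \<Longrightarrow> t \<le> h \<Longrightarrow> x + s *\<^sub>R v + t *\<^sub>R w \<in> S"
  obtains s t where "0 < s" "s < h" "0 < t" "t < h"
    "f (x + h *\<^sub>R v + h *\<^sub>R w) - f (x + h *\<^sub>R v) - f (x + h *\<^sub>R w) + f x
      = h\<^sup>2 * frechet_derivative (\<lambda>y. frechet_derivative f (at y) v)
                (at (x + s *\<^sub>R v + t *\<^sub>R w)) w"
proof -
  let ?fv = "\<lambda>y. frechet_derivative f (at y) v"
  let ?p = "\<lambda>s. f ((x + h *\<^sub>R w) + s *\<^sub>R v) - f (x + s *\<^sub>R v)"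
  have "\<exists>s>0. s < h \<and> ?p h - ?p 0
      = (h - 0) * (?fv ((x + h *\<^sub>R w) + s *\<^sub>R v) - ?fv (x + s *\<^sub>R v))"
  proof (rule MVT2[OF h])
    fix s :: real assume s: "0 \<le> s" "s \<le> h"
    have "f differentiable (at ((x + h *\<^sub>R w) + s *\<^sub>R v))" "f differentiable (at (x + s *\<^sub>R v))"
      using S[OF s, of h] S[OF s, of 0] h
      by (auto intro!: smooth_on_differentiable[OF f] simp: add.commute add.left_commute)
    then show "(?p has_real_derivative
        (?fv ((x + h *\<^sub>R w) + s *\<^sub>R v) - ?fv (x + s *\<^sub>R v))) (at s)"
      by (intro DERIV_diff DERIV_along_line)
  qed
  then obtain s where s: "0 < s" "s < h"
    "?p h - ?p 0 = h * (?fv ((x + h *\<^sub>R w) + s *\<^sub>R v) - ?fv (x + s *\<^sub>R v))"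
    by auto
  have "\<exists>t>0. t < h \<and> ?fv ((x + s *\<^sub>R v) + h *\<^sub>R w) - ?fv ((x + s *\<^sub>R v) + 0 *\<^sub>R w)
      = (h - 0) * frechet_derivative ?fv (at ((x + s *\<^sub>R v) + t *\<^sub>R w)) w"
  proof (rule MVT2[OF h])
    fix t :: real assume t: "0 \<le> t" "t \<le> h"
    have "?fv differentiable (at ((x + s *\<^sub>R v) + t *\<^sub>R w))"
      using S[of s t] s t
      by (auto intro!: smooth_on_differentiable[OF smooth_on_frechet_derivative[OF f]])
    then show "((\<lambda>t. ?fv ((x + s *\<^sub>R v) + t *\<^sub>R w)) has_real_derivative
        frechet_derivative ?fv (at ((x + s *\<^sub>R v) + t *\<^sub>R w)) w) (at t)"
      by (rule DERIV_along_line)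
  qed
  then obtain t where t: "0 < t" "t < h"
    "?fv ((x + s *\<^sub>R v) + h *\<^sub>R w) - ?fv (x + s *\<^sub>R v)
      = h * frechet_derivative ?fv (at (x + s *\<^sub>R v + t *\<^sub>R w)) w"
    by auto
  show ?thesis
    by (rule that[OF s(1,2) t(1,2)])
      (use s(3) t(3) in \<open>simp add: algebra_simps power2_eq_square\<close>)
qed

text \<open>The second difference over the parallelogram spanned by \<open>h v\<close> and
  \<open>h w\<close> is symmetric in \<open>v\<close> and \<open>w\<close>. Evaluated by mean values
  in both orders, it equates the two mixed derivatives at points close to \<open>x\<close>; both are
  continuous, so they agree at \<open>x\<close> up to any \<open>e > 0\<close>.\<close>

lemma frechet_derivative_commute_real:
  fixes f :: "'a::euclidean_space \<Rightarrow> real"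
  assumes f: "smooth_on S f" and S: "open S" "x \<in> S"
  shows "frechet_derivative (\<lambda>y. frechet_derivative f (at y) v) (at x) w
       = frechet_derivative (\<lambda>y. frechet_derivative f (at y) w) (at x) v"
proof -
  let ?g = "\<lambda>v w y. frechet_derivative (\<lambda>y. frechet_derivative f (at y) v) (at y) w"
  have cont: "(?g v w \<longlongrightarrow> ?g v w x) (nhds x)" for v w
  proof -
    have "continuous_on S (?g v w)"
      by (intro smooth_on_continuous_on smooth_on_frechet_derivative f)
    then have "isCont (?g v w) x"
      using S by (simp add: continuous_on_eq_continuous_at)
    then show ?thesis
      using tendsto_at_iff_tendsto_nhds[of "?g v w" x] by (simp add: isCont_def)
  qed
  have "\<bar>?g v w x - ?g w v x\<bar> \<le> e" if e: "e > 0" for e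
  proof -
    have "\<forall>\<^sub>F y in nhds x. dist (?g v w y) (?g v w x) < e/2 \<and> dist (?g w v y) (?g w v x) < e/2 \<and> y \<in> S"
      by (intro eventually_conj tendstoD[OF cont] half_gt_zero e eventually_nhds_in_open S)
    then obtain d where d: "d > 0" and
      dist: "\<And>y. dist y x < d \<Longrightarrow> dist (?g v w y) (?g v w x) < e/2 \<and> dist (?g w v y) (?g w v x) < e/2 \<and> y \<in> S"
      unfolding eventually_nhds_metric by blast
    \<comment> \<open>With \<open>h * K = d / 2\<close> the whole parallelogram stays in the ball of
      radius \<open>d\<close>; the summand 1 keeps \<open>K\<close> positive when \<open>v\<close>
      and \<open>w\<close> vanish.\<close>
    define K where "K = norm v + norm w + 1"
    have K: "K > 0" by (simp add: K_def add_nonneg_pos)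
    define h where "h = d / (2 * K)"
    have h: "h > 0" using d K by (simp add: h_def)
    have near: "dist (x + s *\<^sub>R v + t *\<^sub>R w) x < d" if "0 \<le> s" "s \<le> h" "0 \<le> t" "t \<le> h" for s t
    proof -
      have "dist (x + s *\<^sub>R v + t *\<^sub>R w) x \<le> s * norm v + t * norm w"
        using that norm_triangle_ineq[of "s *\<^sub>R v" "t *\<^sub>R w"] by (simp add: dist_norm)
      also have "\<dots> \<le> h * norm v + h * norm w"
        using that by (intro add_mono mult_right_mono) auto
      also have "\<dots> \<le> h * K" using h by (simp add: K_def algebra_simps)
      also have "\<dots> = d/2" using K by (simp add: h_def)
      finally show ?thesis using d by linarith
    qed
    obtain s t where st: "0 < s" "s < h" "0 < t" "t < h"
      "f (x + h *\<^sub>R v + h *\<^sub>R w) - f (x + h *\<^sub>R v) - f (x + h *\<^sub>R w) + f x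
        = h\<^sup>2 * ?g v w (x + s *\<^sub>R v + t *\<^sub>R w)"
      using second_difference_mean_value[OF f h, of x v w] near dist by (metis (no_types, lifting))
    have near': "dist (x + s *\<^sub>R w + t *\<^sub>R v) x < d" if "0 \<le> s" "s \<le> h" "0 \<le> t" "t \<le> h" for s t
      using near[of t s] that by (simp add: add.commute add.left_commute)
    obtain s' t' where st': "0 < s'" "s' < h" "0 < t'" "t' < h"
      "f (x + h *\<^sub>R w + h *\<^sub>R v) - f (x + h *\<^sub>R w) - f (x + h *\<^sub>R v) + f x
        = h\<^sup>2 * ?g w v (x + s' *\<^sub>R w + t' *\<^sub>R v)"
      using second_difference_mean_value[OF f h, of x w v] near' dist by (metis (no_types, lifting))
    have eq: "x + h *\<^sub>R w + h *\<^sub>R v = x + h *\<^sub>R v + h *\<^sub>R w" by simp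
    have "h\<^sup>2 * ?g v w (x + s *\<^sub>R v + t *\<^sub>R w) = h\<^sup>2 * ?g w v (x + s' *\<^sub>R w + t' *\<^sub>R v)"
      using st(5) st'(5) unfolding eq by linarith
    then have "?g v w (x + s *\<^sub>R v + t *\<^sub>R w) = ?g w v (x + s' *\<^sub>R w + t' *\<^sub>R v)"
      using h by simp
    moreover have "dist (?g v w (x + s *\<^sub>R v + t *\<^sub>R w)) (?g v w x) < e/2"
      using dist[OF near[of s t]] st by simp
    moreover have "dist (?g w v (x + s' *\<^sub>R w + t' *\<^sub>R v)) (?g w v x) < e/2"
      using dist[OF near'[of s' t']] st' by simp
    ultimately show ?thesis unfolding dist_real_def by linarith
  qed
  then have "\<bar>?g v w x - ?g w v x\<bar> \<le> 0" by (rule field_le_epsilon) simp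
  then show ?thesis by simp
qed

text \<open>Pairing with a fixed vector \<open>b\<close> is bounded linear and commutes with
  differentiation, so the real case applies to every \<open>f \<bullet> b\<close>, and these
  products determine the vector.\<close>

lemma frechet_derivative_commute:
  fixes f :: "'a::euclidean_space \<Rightarrow> 'b::real_inner"
  assumes f: "smooth_on S f" and S: "open S" "x \<in> S"
  shows "frechet_derivative (\<lambda>y. frechet_derivative f (at y) v) (at x) w
       = frechet_derivative (\<lambda>y. frechet_derivative f (at y) w) (at x) v"

proof -
  have *: "frechet_derivative (\<lambda>y. frechet_derivative (\<lambda>z. f z \<bullet> b) (at y) v) (at x) w
      = frechet_derivative (\<lambda>y. frechet_derivative f (at y) v) (at x) w \<bullet> b" for b v w
  proof -
    have "frechet_derivative (\<lambda>y. frechet_derivative (\<lambda>z. f z \<bullet> b) (at y) v) (at x)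
        = frechet_derivative (\<lambda>y. frechet_derivative f (at y) v \<bullet> b) (at x)"
      by (rule sym, rule frechet_derivative_transform_within_open[OF _ S])
        (auto simp: frechet_derivative_bounded_linear[OF bounded_linear_inner_left
            smooth_on_differentiable[OF f]]
          intro!: smooth_on_differentiable[OF smooth_on_bounded_linear[OF S(1)
            bounded_linear_inner_left smooth_on_frechet_derivative[OF f]] S(2)])
    then show ?thesis
      by (simp add: frechet_derivative_bounded_linear[OF bounded_linear_inner_left
            smooth_on_differentiable[OF smooth_on_frechet_derivative[OF f] S(2)]])
  qed
  show ?thesis
    using frechet_derivative_commute_real[OF smooth_on_bounded_linear[OF S(1)
        bounded_linear_inner_left f] S, of _ v w]
    unfolding * by (metis vector_eq_rdot)
qed

section \<open>Wirtinger derivatives\<close>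

text \<open>\<open>c = - \<i>\<close> gives the derivative along \<open>z\<close> and \<open>c = \<i>\<close> the one along \<open>cnj z\<close>.\<close>
definition wirtinger :: "complex \<Rightarrow> (complex \<Rightarrow> complex) \<Rightarrow> complex \<Rightarrow> complex" where
  "wirtinger c f z = (frechet_derivative f (at z) 1 + c * frechet_derivative f (at z) \<i>) / 2"

lemma d_z_eq_wirtinger: "d_z = wirtinger (- \<i>)"
  and d_zbar_eq_wirtinger: "d_zbar = wirtinger \<i>"
  by (simp_all add: fun_eq_iff wirtinger_def d_z_def d_zbar_def)

text \<open>Real linearity on the basis 1, \<i> gives df = f_z dz + f_zbar d(cnj z), the link
  between the real differential in \<open>mc_form\<close> and the Wirtinger derivatives.\<close>

lemma frechet_derivative_eq_wirtinger:
  assumes "f differentiable (at z)"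
  shows "frechet_derivative f (at z) v = wirtinger (- \<i>) f z * v + wirtinger \<i> f z * cnj v"
proof -
  have lin: "linear (frechet_derivative f (at z))" using assms by (rule linear_frechet_derivative)
  have v: "v = Re v *\<^sub>R 1 + Im v *\<^sub>R \<i>" by (simp add: complex_eq_iff)
  have "frechet_derivative f (at z) v
      = Re v *\<^sub>R frechet_derivative f (at z) 1 + Im v *\<^sub>R frechet_derivative f (at z) \<i>"
    by (subst v) (simp only: linear_add[OF lin] linear_scale[OF lin])
  then show ?thesis
    by (simp add: wirtinger_def complex_eq_iff field_simps)
qed

lemma wirtinger_cong:
  assumes "open S" "z \<in> S" "f differentiable (at z)" "\<And>w. w \<in> S \<Longrightarrow> f w = g w"
  shows "wirtinger c f z = wirtinger c g z"
  using frechet_derivative_transform_within_open[OF assms(3,1,2,4)] by (simp add: wirtinger_def)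

lemma wirtinger_const [simp]: "wirtinger c (\<lambda>w. k) z = 0"
  by (simp add: wirtinger_def)

lemma wirtinger_add:
  assumes "f differentiable (at z)" "g differentiable (at z)"
  shows "wirtinger c (\<lambda>w. f w + g w) z = wirtinger c f z + wirtinger c g z"
proof -
  have "frechet_derivative (\<lambda>w. f w + g w) (at z)
      = (\<lambda>v. frechet_derivative f (at z) v + frechet_derivative g (at z) v)"
    using assms by (intro frechet_derivative_at[symmetric] has_derivative_add)
      (simp_all add: frechet_derivative_works)
  then show ?thesis by (simp add: wirtinger_def algebra_simps add_divide_distrib)
qed

lemma wirtinger_sum:
  "finite I \<Longrightarrow> (\<And>i. i \<in> I \<Longrightarrow> f i differentiable (at z)) \<Longrightarrow>
    wirtinger c (\<lambda>w. \<Sum>i\<in>I. f i w) z = (\<Sum>i\<in>I. wirtinger c (f i) z)"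
  by (induction I rule: finite_induct) (simp_all add: wirtinger_add)

lemma wirtinger_mult:
  assumes "f differentiable (at z)" "g differentiable (at z)"
  shows "wirtinger c (\<lambda>w. f w * g w) z = wirtinger c f z * g z + f z * wirtinger c g z"
proof -
  have "frechet_derivative (\<lambda>w. f w * g w) (at z)
      = (\<lambda>v. f z * frechet_derivative g (at z) v + frechet_derivative f (at z) v * g z)"
    using assms by (intro frechet_derivative_at[symmetric] has_derivative_mult)
      (simp_all add: frechet_derivative_works)
  then show ?thesis by (simp add: wirtinger_def algebra_simps add_divide_distrib)
qed

lemma wirtinger_cnj:
  assumes "f differentiable (at z)"
  shows "wirtinger c (\<lambda>w. cnj (f w)) z = cnj (wirtinger (cnj c) f z)"
  by (simp add: wirtinger_def frechet_derivative_bounded_linear[OF bounded_linear_cnj assms])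

lemma wirtinger_inverse:
  assumes "f differentiable (at z)" "f z \<noteq> 0"
  shows "wirtinger c (\<lambda>w. inverse (f w)) z = - wirtinger c f z / (f z)\<^sup>2"
proof -
  have "frechet_derivative (\<lambda>w. inverse (f w)) (at z)
      = (\<lambda>v. - (inverse (f z) * frechet_derivative f (at z) v * inverse (f z)))"
    using assms by (intro frechet_derivative_at[symmetric] Deriv.has_derivative_inverse)
      (simp_all add: frechet_derivative_works)
  then show ?thesis using assms(2) by (simp add: wirtinger_def field_simps power2_eq_square)
qed

text \<open>The factor \<open>k\<close> is kept because the exponential occurs with
  \<open>k = 1\<close> for |a|^2 and with \<open>k = - 1 / 2\<close> in the gauge.\<close>

lemma wirtinger_of_real_exp:
  assumes "p differentiable (at z)"
  shows "wirtinger c (\<lambda>w. of_real (exp (k * p w))) z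
      = k * of_real (exp (k * p z)) * wirtinger c (\<lambda>w. of_real (p w)) z"
proof -
  have p: "(p has_derivative frechet_derivative p (at z)) (at z)"
    using assms by (simp add: frechet_derivative_works)
  have e: "((\<lambda>w. exp (k * p w)) has_derivative (\<lambda>v. k * frechet_derivative p (at z) v * exp (k * p z))) (at z)"
    by (auto intro!: derivative_eq_intros p)
  have "frechet_derivative (\<lambda>w. complex_of_real (exp (k * p w))) (at z)
      = (\<lambda>v. of_real (k * frechet_derivative p (at z) v * exp (k * p z)))"
    "frechet_derivative (\<lambda>w. complex_of_real (p w)) (at z) = (\<lambda>v. of_real (frechet_derivative p (at z) v))"
    by (rule frechet_derivative_at[symmetric],
        rule bounded_linear.has_derivative[OF bounded_linear_of_real], fact e p)+
  then show ?thesis by (simp add: wirtinger_def algebra_simps add_divide_distrib)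
qed

lemma smooth_on_wirtinger:
  assumes "open S" "smooth_on S f"
  shows "smooth_on S (wirtinger c f)"
proof -
  have "smooth_on S (\<lambda>z. frechet_derivative f (at z) 1 * (1/2) + (c/2) * frechet_derivative f (at z) \<i>)"
    by (intro smooth_on_add smooth_on_mult smooth_on_const smooth_on_frechet_derivative assms)
  then show ?thesis by (rule smooth_on_cong[OF assms(1)]) (simp add: wirtinger_def add_divide_distrib)
qed

text \<open>Both sides expand into second derivatives along 1 and \<i>; exchanging \<open>c\<close>
  and \<open>d\<close> only exchanges the two mixed ones, which are equal.\<close>

lemma wirtinger_commute:
  assumes S: "open S" "z \<in> S" and f: "smooth_on S f"
  shows "wirtinger c (wirtinger d f) z = wirtinger d (wirtinger c f) z"
proof -
  have *: "frechet_derivative (wirtinger c f) (at z) v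
      = (frechet_derivative (\<lambda>z. frechet_derivative f (at z) 1) (at z) v
          + c * frechet_derivative (\<lambda>z. frechet_derivative f (at z) \<i>) (at z) v) / 2" for c v
  proof -
    let ?f = "\<lambda>v w. frechet_derivative f (at w) v"
    have d: "(?f v has_derivative frechet_derivative (?f v) (at z)) (at z)" for v
      using smooth_on_differentiable[OF smooth_on_frechet_derivative[OF f] S(2)]
      by (simp add: frechet_derivative_works)
    have "((\<lambda>w. ?f 1 w * (1/2) + (c/2) * ?f \<i> w) has_derivative
        (\<lambda>v. frechet_derivative (?f 1) (at z) v * (1/2) + (c/2) * frechet_derivative (?f \<i>) (at z) v)) (at z)"
      by (auto intro!: derivative_eq_intros d)
    moreover have "wirtinger c f = (\<lambda>w. ?f 1 w * (1/2) + (c/2) * ?f \<i> w)"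
      by (simp add: fun_eq_iff wirtinger_def add_divide_distrib)
    ultimately show ?thesis by (simp add: frechet_derivative_at[symmetric] add_divide_distrib)
  qed
  show ?thesis
    unfolding wirtinger_def[of _ "wirtinger _ _"] *
    using frechet_derivative_commute[OF f S, of 1 \<i>] by (simp add: field_simps)
qed

section \<open>Matrix-valued functions\<close>

definition mat_wirtinger :: "complex \<Rightarrow> (complex \<Rightarrow> mat3) \<Rightarrow> complex \<Rightarrow> mat3" where
  "mat_wirtinger c f z = (\<chi> i j. wirtinger c (\<lambda>w. f w $ i $ j) z)"

lemma mat_wirtinger_nth [simp]: "mat_wirtinger c f z $ i $ j = wirtinger c (\<lambda>w. f w $ i $ j) z"
  by (simp add: mat_wirtinger_def)

lemma mat_wirtinger_const [simp]: "mat_wirtinger c (\<lambda>w. A) z = 0"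
  by (simp add: vec_eq_iff)

lemma matrix_mult_zero [simp]: "A ** 0 = (0 :: 'a::semiring_1^'n^'m)" "0 ** A = (0 :: 'a::semiring_1^'n^'m)"
  by (simp_all add: vec_eq_iff matrix_matrix_mult_def)

lemma matrix_add_rdistrib: "(A + B) ** C = A ** C + (B ** C :: 'a::semiring_1^'n^'m)"
  by (simp add: vec_eq_iff matrix_matrix_mult_def distrib_right sum.distrib)

lemma differentiable_nth:
  fixes f :: "'a::real_normed_vector \<Rightarrow> 'b::real_normed_vector^'n"
  shows "f differentiable (at z) \<Longrightarrow> (\<lambda>w. f w $ i) differentiable (at z)"
  using bounded_linear.has_derivative[OF bounded_linear_vec_nth] unfolding differentiable_def by blast

lemma mat_wirtinger_mult:
  assumes "f differentiable (at z)" "g differentiable (at z)"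
  shows "mat_wirtinger c (\<lambda>w. f w ** g w) z = mat_wirtinger c f z ** g z + f z ** mat_wirtinger c g z"
  using assms
  by (simp add: vec_eq_iff matrix_matrix_mult_def wirtinger_sum wirtinger_mult differentiable_nth
      differentiable_mult sum.distrib)

lemma mat_wirtinger_transpose:
  "mat_wirtinger c (\<lambda>w. transpose (f w)) z = transpose (mat_wirtinger c f z)"
  by (simp add: vec_eq_iff transpose_def)

lemma mat_wirtinger_cnj:
  assumes "f differentiable (at z)"
  shows "mat_wirtinger c (\<lambda>w. map_matrix cnj (f w)) z = map_matrix cnj (mat_wirtinger (cnj c) f z)"
  by (simp add: vec_eq_iff wirtinger_cnj differentiable_nth assms)

lemma mat_wirtinger_cong:
  assumes "open S" "z \<in> S" "f differentiable (at z)" "\<And>w. w \<in> S \<Longrightarrow> f w = g w"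
  shows "mat_wirtinger c f z = mat_wirtinger c g z"
  by (simp add: vec_eq_iff wirtinger_cong[OF assms(1,2) differentiable_nth[OF differentiable_nth]] assms)

lemma frechet_derivative_eq_mat_wirtinger:
  assumes "f differentiable (at z)"
  shows "frechet_derivative f (at z) v
      = map_matrix (\<lambda>y. y * v) (mat_wirtinger (- \<i>) f z) + map_matrix (\<lambda>y. y * cnj v) (mat_wirtinger \<i> f z)"
proof -
  have "frechet_derivative f (at z) v $ i $ j = frechet_derivative (\<lambda>w. f w $ i $ j) (at z) v" for i j
    using frechet_derivative_bounded_linear[OF bounded_linear_vec_nth assms, of i]
      frechet_derivative_bounded_linear[OF bounded_linear_vec_nth differentiable_nth[OF assms], of i j]
    by (simp only:)
  then show ?thesis
    by (simp add: vec_eq_iff frechet_derivative_eq_wirtinger[OF differentiable_nth[OF differentiable_nth[OF assms]]])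
qed

lemma smooth_on_matrix:
  fixes f :: "'a::euclidean_space \<Rightarrow> 'b::real_normed_vector^'n^'m"
  shows "open S \<Longrightarrow> (\<And>i j. smooth_on S (\<lambda>x. f x $ i $ j)) \<Longrightarrow> smooth_on S f"
  by (intro smooth_on_vec_lambda) auto

lemma smooth_on_matrix_mult:
  fixes f :: "'a::euclidean_space \<Rightarrow> 'b::{real_normed_algebra,semiring_1}^'n^'m" and g :: "'a \<Rightarrow> 'b^'k^'n"
  assumes "open S" "smooth_on S f" "smooth_on S g"
  shows "smooth_on S (\<lambda>x. f x ** g x)"
  by (rule smooth_on_matrix[OF assms(1)])
    (simp add: matrix_matrix_mult_def smooth_on_sum smooth_on_mult smooth_on_vec_nth assms)

lemma smooth_on_mat_wirtinger:
  "open S \<Longrightarrow> smooth_on S f \<Longrightarrow> smooth_on S (mat_wirtinger c f)"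
  by (intro smooth_on_matrix) (simp_all add: smooth_on_wirtinger smooth_on_vec_nth)

lemma mat_wirtinger_commute:
  assumes S: "open S" "z \<in> S" and f: "smooth_on S f"
  shows "mat_wirtinger c (mat_wirtinger d f) z = mat_wirtinger d (mat_wirtinger c f) z"
  using wirtinger_commute[OF S smooth_on_vec_nth[OF S(1) smooth_on_vec_nth[OF S(1) f]]]
  by (simp add: vec_eq_iff)

section \<open>Inverse matrices and flatness of a logarithmic derivative\<close>

lemma matrix_mult_left_cancel:
  fixes A :: "'a::field^'n^'n"
  assumes "det A \<noteq> 0" "A ** X = A ** Y"
  shows "X = Y"
  using assms by (metis invertible_det_nz invertible_def matrix_mul_assoc matrix_mul_lid)

lemma matrix_inv_cancel:
  fixes A :: "'a::field^'n^'n"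
  assumes "det A \<noteq> 0"
  shows "matrix_inv A ** A = mat 1" "A ** matrix_inv A = mat 1"
  using assms unfolding invertible_det_nz[symmetric] invertible_def matrix_inv_def
  by (metis (mono_tags, lifting) someI_ex)+

text \<open>For square matrices over a field a right inverse is the two-sided inverse, so one
  product identifies \<open>matrix_inv\<close>.\<close>

lemma matrix_inv_eqI:
  fixes A :: "'a::field^'n^'n"
  assumes "A ** B = mat 1"
  shows "matrix_inv A = B"
  by (metis assms invertible_det_nz invertible_right_inverse matrix_inv_cancel(1) matrix_mul_assoc
      matrix_mul_lid matrix_mul_rid)

text \<open>Multiplied by the invertible \<open>f z\<close>, the two sides are the two mixed second
  derivatives of \<open>f\<close>, by the product rule applied to \<open>f ** M\<close> and
  \<open>f ** N\<close>.\<close>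

lemma maurer_cartan_flat:
  assumes S: "open S" "z \<in> S" and f: "smooth_on S f" and M: "smooth_on S M" and N: "smooth_on S N"
    and det: "det (f z) \<noteq> 0"
    and fz: "\<And>w. w \<in> S \<Longrightarrow> mat_wirtinger (- \<i>) f w = f w ** M w"
    and fzb: "\<And>w. w \<in> S \<Longrightarrow> mat_wirtinger \<i> f w = f w ** N w"
  shows "mat_wirtinger \<i> M z + N z ** M z = mat_wirtinger (- \<i>) N z + M z ** N z"
proof (rule matrix_mult_left_cancel[OF det])
  note d = smooth_on_differentiable[OF _ S(2)]
  note sw = smooth_on_mat_wirtinger[OF S(1) f]
  have "f z ** (mat_wirtinger \<i> M z + N z ** M z) = mat_wirtinger \<i> (\<lambda>w. f w ** M w) z"
    using fzb[OF S(2)] by (simp add: mat_wirtinger_mult d f M matrix_add_ldistrib matrix_mul_assoc)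
  also have "\<dots> = mat_wirtinger \<i> (mat_wirtinger (- \<i>) f) z"
    by (rule mat_wirtinger_cong[OF S d[OF sw] fz, symmetric])
  also have "\<dots> = mat_wirtinger (- \<i>) (mat_wirtinger \<i> f) z"
    by (rule mat_wirtinger_commute[OF S f])
  also have "\<dots> = mat_wirtinger (- \<i>) (\<lambda>w. f w ** N w) z"
    by (rule mat_wirtinger_cong[OF S d[OF sw] fzb])
  also have "\<dots> = f z ** (mat_wirtinger (- \<i>) N z + M z ** N z)"
    using fz[OF S(2)] by (simp add: mat_wirtinger_mult d f N matrix_add_ldistrib matrix_mul_assoc)
  finally show "f z ** (mat_wirtinger \<i> M z + N z ** M z) = f z ** (mat_wirtinger (- \<i>) N z + M z ** N z)" .
qed

section \<open>The twisting conditions\<close>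

lemma eps_cube: "eps ^ 3 = -1"
  by (simp add: eps_def exp_of_nat_mult[symmetric] mult.left_commute)

lemma Re_eps: "Re eps = 1/2"
  by (simp add: eps_def Re_exp cos_60)

text \<open>\<open>eps\<close> is a root of x^3 + 1 = (x + 1)(x^2 - x + 1) other than -1. This
  quadratic relation carries the later computations with \<open>P_mat\<close>.\<close>

lemma eps_square: "eps\<^sup>2 = eps - 1"
proof -
  have "eps \<noteq> -1"
  proof
    assume "eps = -1"
    then have "Re eps = Re (-1)" by (rule arg_cong)
    then show False using Re_eps by simp
  qed
  moreover have "(eps + 1) * (eps\<^sup>2 - eps + 1) = 0"
    using eps_cube by (simp add: algebra_simps power2_eq_square power3_eq_cube)
  ultimately show ?thesis
    by (metis add_eq_0_iff2 diff_add_eq diff_eq_eq eq_iff_diff_eq_0 mult_eq_0_iff minus_minus)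
qed

lemma eps_nonzero: "eps \<noteq> 0"
  by (simp add: eps_def)

lemma P_mat_alt: "P_mat = vector [vector [0, - eps, 0], vector [eps - 1, 0, 0], vector [0, 0, 1]]"
proof -
  have "eps ^ 4 = - eps" using eps_cube by (simp add: eval_nat_numeral)
  then show ?thesis by (simp add: P_mat_def eps_square)
qed

lemmas mat3_eq_simps = vec_eq_iff forall_3 sum_3 matrix_matrix_mult_def transpose_def mat_def

lemma P_mat_involution: "P_mat ** P_mat = mat 1"
  using eps_square
  by (simp add: mat3_eq_simps P_mat_alt power2_eq_square algebra_simps)

lemma transpose_P_mat_involution: "transpose P_mat ** transpose P_mat = mat 1"
  by (metis P_mat_involution matrix_transpose_mul transpose_mat)

lemma T_mat_involution: "H = 2 \<or> H = - 2 \<Longrightarrow> T_mat H ** T_mat H = mat 1"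
  by (auto simp: mat3_eq_simps T_mat_def)


text \<open>Used with \<open>k = eps\<close> for the coefficient of \<lambda> and with
  \<open>k = 1\<close> for the constant one. Since \<open>P_mat\<close> swaps the indices 1 and 2 up
  to factors and fixes 3, each equation involves at most two entries.\<close>

lemma twisted_entries:
  assumes "map_matrix ((*) k) A ** P_mat + P_mat ** transpose A = 0"
  shows "k * A $ 1 $ 2 * (eps - 1) - eps * A $ 1 $ 2 = 0"
    "k * A $ 1 $ 1 * eps + eps * A $ 2 $ 2 = 0"
    "k * A $ 1 $ 3 - eps * A $ 3 $ 2 = 0"
    "k * A $ 2 $ 2 * (eps - 1) + (eps - 1) * A $ 1 $ 1 = 0"
    "(eps - 1) * A $ 2 $ 1 - k * A $ 2 $ 1 * eps = 0"
    "k * A $ 2 $ 3 + (eps - 1) * A $ 3 $ 1 = 0"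
    "k * A $ 3 $ 2 * (eps - 1) + A $ 1 $ 3 = 0"
    "A $ 2 $ 3 - k * A $ 3 $ 1 * eps = 0"
    "k * A $ 3 $ 3 + A $ 3 $ 3 = 0"
proof -
  let ?X = "map_matrix ((*) k) A ** P_mat + P_mat ** transpose A"
  have
    "k * A $ 1 $ 2 * (eps - 1) - eps * A $ 1 $ 2 = ?X $ 1 $ 1"
    "k * A $ 1 $ 1 * eps + eps * A $ 2 $ 2 = - ?X $ 1 $ 2"
    "k * A $ 1 $ 3 - eps * A $ 3 $ 2 = ?X $ 1 $ 3"
    "k * A $ 2 $ 2 * (eps - 1) + (eps - 1) * A $ 1 $ 1 = ?X $ 2 $ 1"
    "(eps - 1) * A $ 2 $ 1 - k * A $ 2 $ 1 * eps = ?X $ 2 $ 2"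
    "k * A $ 2 $ 3 + (eps - 1) * A $ 3 $ 1 = ?X $ 2 $ 3"
    "k * A $ 3 $ 2 * (eps - 1) + A $ 1 $ 3 = ?X $ 3 $ 1"
    "A $ 2 $ 3 - k * A $ 3 $ 1 * eps = ?X $ 3 $ 2"
    "k * A $ 3 $ 3 + A $ 3 $ 3 = ?X $ 3 $ 3"
    by (simp_all add: matrix_matrix_mult_def sum_3 transpose_def P_mat_alt)
  then show
    "k * A $ 1 $ 2 * (eps - 1) - eps * A $ 1 $ 2 = 0"
    "k * A $ 1 $ 1 * eps + eps * A $ 2 $ 2 = 0"
    "k * A $ 1 $ 3 - eps * A $ 3 $ 2 = 0"
    "k * A $ 2 $ 2 * (eps - 1) + (eps - 1) * A $ 1 $ 1 = 0"
    "(eps - 1) * A $ 2 $ 1 - k * A $ 2 $ 1 * eps = 0"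
    "k * A $ 2 $ 3 + (eps - 1) * A $ 3 $ 1 = 0"
    "k * A $ 3 $ 2 * (eps - 1) + A $ 1 $ 3 = 0"
    "A $ 2 $ 3 - k * A $ 3 $ 1 * eps = 0"
    "k * A $ 3 $ 3 + A $ 3 $ 3 = 0"
    unfolding assms by simp_all
qed

text \<open>The hypothesis says that \<open>A\<close> is an eigenvector for \<open>eps\<close> of X
  -> - P X^t P, the differential of \<open>sigma\<close>. The equations force an entry to vanish
  unless they are dependent, which happens exactly for entry 21 and for the pair 13, 32.\<close>

lemma twisted_entries_eps:
  assumes "map_matrix ((*) eps) A ** P_mat + P_mat ** transpose A = 0"
  shows "A $ 1 $ 1 = 0" "A $ 1 $ 2 = 0" "A $ 2 $ 2 = 0" "A $ 2 $ 3 = 0" "A $ 3 $ 1 = 0" "A $ 3 $ 3 = 0"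
    and "A $ 3 $ 2 = A $ 1 $ 3"
proof -
  \<comment> \<open>The real part 1/2 of \<open>eps\<close> excludes these zeros.\<close>
  have nz: "eps - 2 \<noteq> 0" "eps + 1 \<noteq> 0"
    using Re_eps by (auto simp: complex_eq_iff)
  have e: "eps * eps = eps - 1" using eps_square by (simp add: power2_eq_square)
  note eqs = twisted_entries[OF assms]
  have "eps * (eps - 2) * A $ 1 $ 2 = 0" using eqs(1) by (simp add: algebra_simps)
  then show "A $ 1 $ 2 = 0" using nz eps_nonzero by simp
  have 2: "A $ 2 $ 2 = - eps * A $ 1 $ 1" using eqs(2) eps_nonzero by algebra
  have "(eps - 1) * (eps - 2) * A $ 1 $ 1 = 0" using eqs(4) e unfolding 2 by algebra
  moreover have "eps - 1 \<noteq> 0" using Re_eps by (auto simp: complex_eq_iff)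
  ultimately show "A $ 1 $ 1 = 0" using nz by simp
  then show "A $ 2 $ 2 = 0" using 2 by simp
  show "A $ 3 $ 2 = A $ 1 $ 3" using eqs(3) eps_nonzero by simp
  have 3: "A $ 2 $ 3 = (eps - 1) * A $ 3 $ 1" using eqs(8) e by algebra
  have "(eps - 2) * A $ 3 $ 1 = 0" using eqs(6) e unfolding 3 by algebra
  then show "A $ 3 $ 1 = 0" using nz by simp
  then show "A $ 2 $ 3 = 0" using 3 by simp
  have "(eps + 1) * A $ 3 $ 3 = 0" using eqs(9) by (simp add: algebra_simps)
  then show "A $ 3 $ 3 = 0" using nz by simp
qed

text \<open>Here \<open>B\<close> is fixed by the differential of \<open>sigma\<close>; what
  survives is diag(c, -c, 0), the complexified Lie algebra of the gauge group.\<close>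

lemma twisted_entries_1:
  assumes "B ** P_mat + P_mat ** transpose B = 0"
  shows "B $ 1 $ 2 = 0" "B $ 1 $ 3 = 0" "B $ 2 $ 1 = 0" "B $ 2 $ 3 = 0" "B $ 3 $ 1 = 0" "B $ 3 $ 2 = 0"
      "B $ 3 $ 3 = 0"
    and "B $ 2 $ 2 = - B $ 1 $ 1"
proof -
  have "(2 * eps - 1)\<^sup>2 = -3" using eps_square by algebra
  then have nz: "2 * eps - 1 \<noteq> 0" by auto
  have "map_matrix ((*) 1) B = B" by (simp add: vec_eq_iff)
  then have "map_matrix ((*) 1) B ** P_mat + P_mat ** transpose B = 0" using assms by (simp only:)
  note eqs = twisted_entries[OF this, simplified]
  show "B $ 1 $ 2 = 0" "B $ 2 $ 1 = 0" "B $ 3 $ 3 = 0"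
    using eqs(1,5,9) by (simp_all add: algebra_simps)
  have "eps * (B $ 2 $ 2 + B $ 1 $ 1) = 0" using eqs(2) by (simp add: algebra_simps)
  then show "B $ 2 $ 2 = - B $ 1 $ 1" using eps_nonzero by (simp add: add_eq_0_iff2)
  have "(2 * eps - 1) * B $ 3 $ 2 = 0" "(2 * eps - 1) * B $ 3 $ 1 = 0"
    using eqs(3,6-8) by algebra+
  then show "B $ 3 $ 2 = 0" "B $ 3 $ 1 = 0" using nz by simp_all
  then show "B $ 1 $ 3 = 0" "B $ 2 $ 3 = 0" using eqs(3,8) by simp_all
qed

section \<open>The two parts of the Maurer-Cartan form, and the twisting conditions as product
  identities\<close>

lemma map_matrix_cnj_mult: "map_matrix cnj (A ** B) = map_matrix cnj A ** map_matrix cnj B"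
  by (simp add: vec_eq_iff matrix_matrix_mult_def)

text \<open>For \<open>c = - \<i>\<close> this is F^{-1} F_z, and for \<open>c = \<i>\<close> it is
  the coefficient of d(cnj z); one definition serves both.\<close>

definition maurer :: "complex \<Rightarrow> (complex \<Rightarrow> complex \<Rightarrow> mat3) \<Rightarrow> complex \<Rightarrow> complex \<Rightarrow> mat3" where
  "maurer c F l z = matrix_inv (F z l) ** mat_wirtinger c (\<lambda>w. F w l) z"

lemma mc_z_eq_maurer: "mc_z F l z = maurer (- \<i>) F l z"
  by (simp add: mc_z_def maurer_def mat_wirtinger_def d_z_eq_wirtinger)

lemma matrix_scaleC_right: "A ** map_matrix (\<lambda>y. y * v) B = map_matrix (\<lambda>y. y * v) (A ** B)" for v :: complex
  by (simp add: vec_eq_iff matrix_matrix_mult_def sum_distrib_right mult.assoc)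

lemma mc_form_eq_maurer:
  assumes "(\<lambda>w. F w l) differentiable (at z)"
  shows "mc_form F l z v
    = map_matrix (\<lambda>y. y * v) (maurer (- \<i>) F l z) + map_matrix (\<lambda>y. y * cnj v) (maurer \<i> F l z)"
  by (simp add: mc_form_def maurer_def frechet_derivative_eq_mat_wirtinger[OF assms]
      matrix_add_ldistrib matrix_scaleC_right)

lemma P_mat_inv: "matrix_inv P_mat = P_mat"
  by (rule matrix_inv_eqI[OF P_mat_involution])

lemma T_mat_inv: "H = 2 \<or> H = - 2 \<Longrightarrow> matrix_inv (T_mat H) = T_mat H"
  by (rule matrix_inv_eqI[OF T_mat_involution])

text \<open>Clearing the inverse of the transpose turns the condition into a product identity that
  can be differentiated directly; \<open>P_mat\<close> is its own inverse.\<close>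

lemma sigma_eq_iff:
  assumes "det g = 1"
  shows "sigma g = k \<longleftrightarrow> k ** P_mat ** transpose g = P_mat"
proof -
  let ?gt = "matrix_inv (transpose g)"
  have g: "?gt ** transpose g = mat 1" "transpose g ** ?gt = mat 1"
    using assms by (auto intro!: matrix_inv_cancel)
  have "sigma g ** P_mat ** transpose g = P_mat ** ?gt ** (P_mat ** P_mat) ** transpose g"
    by (simp add: sigma_def P_mat_inv matrix_mul_assoc)
  also have "\<dots> = P_mat"
    using g by (simp add: P_mat_involution matrix_mul_assoc[symmetric])
  finally have "sigma g ** P_mat ** transpose g = P_mat" .
  moreover have "sigma g = k" if "k ** P_mat ** transpose g = P_mat"
  proof -
    have "sigma g = (k ** P_mat ** transpose g) ** ?gt ** P_mat"
      using that by (simp add: sigma_def P_mat_inv)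
    also have "\<dots> = k ** P_mat ** (transpose g ** ?gt) ** P_mat"
      by (simp add: matrix_mul_assoc)
    also have "\<dots> = k ** (P_mat ** P_mat)" using g by (simp add: matrix_mul_assoc)
    finally show ?thesis by (simp add: P_mat_involution)
  qed
  ultimately show ?thesis by auto
qed

text \<open>For H = 2 or H = -2 the matrix \<open>T_mat H\<close> is an involution, so its inverse
  moves to the other side.\<close>

lemma tau_eq_iff:
  assumes "H = 2 \<or> H = - 2"
  shows "tau H g = k \<longleftrightarrow> T_mat H ** map_matrix cnj g = k ** T_mat H"
proof -
  have T: "T_mat H ** T_mat H = mat 1" by (rule T_mat_involution[OF assms])
  have "tau H g = T_mat H ** map_matrix cnj g ** T_mat H"
    by (simp add: tau_def T_mat_inv[OF assms])
  then show ?thesis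
    by (metis T matrix_mul_assoc matrix_mul_rid)
qed

section \<open>Maps into the twisted loop group and their logarithmic derivatives\<close>

locale twisted_frame =
  fixes H :: real and D :: "complex set" and F :: "complex \<Rightarrow> complex \<Rightarrow> mat3"
  assumes H: "H = 2 \<or> H = - 2" and open_D: "open D" and F: "smooth_loop_map H D F"
begin

lemma loop: "z \<in> D \<Longrightarrow> F z \<in> twisted_loop_group H"
  using F by (simp add: smooth_loop_map_def)

lemma det_F: "z \<in> D \<Longrightarrow> l \<noteq> 0 \<Longrightarrow> det (F z l) = 1"
  using loop by (simp add: twisted_loop_group_def)

lemma sigma_relation: "z \<in> D \<Longrightarrow> l \<noteq> 0 \<Longrightarrow> F z (eps * l) ** P_mat ** transpose (F z l) = P_mat"
  using loop[of z] det_F by (simp add: twisted_loop_group_def flip: sigma_eq_iff)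

lemma tau_relation:
  "z \<in> D \<Longrightarrow> l \<noteq> 0 \<Longrightarrow> T_mat H ** map_matrix cnj (F z (inverse (cnj l))) = F z l ** T_mat H"
  using loop[of z] by (simp add: twisted_loop_group_def flip: tau_eq_iff[OF H])

lemma smooth_F:
  assumes "l \<noteq> 0"
  shows "smooth_on D (\<lambda>z. F z l)"
proof -
  \<comment> \<open>The slice at fixed \<open>l\<close> is the joint map composed with the affine
    embedding of \<open>z\<close> as \<open>(0, l) + (z, 0)\<close>.\<close>
  have "smooth_on D (\<lambda>z. (\<lambda>(z, l). F z l) ((0, l) + (z, 0)))"
  proof (rule smooth_on_compose_affine)
    show "open (D \<times> (- {0 :: complex}))" using open_D by (intro open_Times) auto
    show "bounded_linear (\<lambda>z::complex. (z, 0 :: complex))"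
      by (intro bounded_linear_Pair bounded_linear_ident bounded_linear_zero)
    show "smooth_on (D \<times> - {0}) (\<lambda>(z, l). F z l)" using F by (simp add: smooth_loop_map_def)
  qed (use assms open_D in auto)
  then show ?thesis by simp
qed

lemma differentiable_F: "z \<in> D \<Longrightarrow> l \<noteq> 0 \<Longrightarrow> (\<lambda>w. F w l) differentiable (at z)"
  by (rule smooth_on_differentiable[OF smooth_F])

lemma mat_wirtinger_F:
  "z \<in> D \<Longrightarrow> l \<noteq> 0 \<Longrightarrow> mat_wirtinger c (\<lambda>w. F w l) z = F z l ** maurer c F l z"
  by (simp add: maurer_def matrix_mul_assoc matrix_inv_cancel det_F)

text \<open>The \<sigma>-condition expresses the inverse through the value of \<open>F\<close> at
  \<open>eps * l\<close>, so smoothness of the inverse, and hence of \<open>maurer\<close>, follows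
  from that of \<open>F\<close>.\<close>

lemma matrix_inv_F:
  assumes "z \<in> D" "l \<noteq> 0"
  shows "matrix_inv (F z l) = transpose P_mat ** transpose (F z (eps * l)) ** transpose P_mat"
proof (rule matrix_inv_eqI)
  have "F z l ** (transpose P_mat ** transpose (F z (eps * l)) ** transpose P_mat)
      = transpose (F z (eps * l) ** P_mat ** transpose (F z l)) ** transpose P_mat"
    by (simp add: matrix_transpose_mul transpose_transpose matrix_mul_assoc)
  also have "\<dots> = mat 1" by (simp add: sigma_relation[OF assms] transpose_P_mat_involution)
  finally show "F z l ** (transpose P_mat ** transpose (F z (eps * l)) ** transpose P_mat) = mat 1" .
qed

lemma smooth_maurer:
  assumes "l \<noteq> 0"
  shows "smooth_on D (maurer c F l)"
proof -
  have l: "eps * l \<noteq> 0" using assms eps_nonzero by simp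
  have t: "smooth_on D (\<lambda>z. transpose (F z (eps * l)))"
    using smooth_F[OF l] by (intro smooth_on_matrix[OF open_D])
      (simp add: transpose_def smooth_on_vec_nth open_D)
  have "smooth_on D (\<lambda>z. (transpose P_mat ** transpose (F z (eps * l)) ** transpose P_mat)
          ** mat_wirtinger c (\<lambda>w. F w l) z)"
    by (intro smooth_on_matrix_mult open_D smooth_on_const t smooth_on_mat_wirtinger smooth_F assms)
  then show ?thesis
    by (rule smooth_on_cong[OF open_D]) (simp add: maurer_def matrix_inv_F assms)
qed

text \<open>The product in \<open>sigma_relation\<close> is constant in \<open>z\<close>. Its
  derivative therefore vanishes, and the invertible outer factors \<open>F z (eps * l)\<close> and
  \<open>transpose (F z l)\<close> cancel.\<close>

lemma maurer_sigma:
  assumes "z \<in> D" "l \<noteq> 0"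
  shows "maurer c F (eps * l) z ** P_mat + P_mat ** transpose (maurer c F l z) = 0"
proof -
  have l: "eps * l \<noteq> 0" using assms eps_nonzero by simp
  have t: "smooth_on D (\<lambda>z. transpose (F z l))"
    using smooth_F[OF assms(2)] by (intro smooth_on_matrix[OF open_D])
      (simp add: transpose_def smooth_on_vec_nth open_D)
  have FP: "smooth_on D (\<lambda>z. F z (eps * l) ** P_mat)"
    by (intro smooth_on_matrix_mult open_D smooth_F l smooth_on_const)
  note d = smooth_on_differentiable[OF _ assms(1)]
  have "0 = mat_wirtinger c (\<lambda>w. F w (eps * l) ** P_mat ** transpose (F w l)) z"
    using mat_wirtinger_cong[OF open_D assms(1) d[OF smooth_on_matrix_mult[OF open_D FP t]], of "\<lambda>_. P_mat"]
    by (simp add: sigma_relation assms)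
  also have "\<dots> = F z (eps * l) ** maurer c F (eps * l) z ** P_mat ** transpose (F z l)
      + F z (eps * l) ** P_mat ** transpose (F z l ** maurer c F l z)"
    by (simp add: mat_wirtinger_mult d[OF FP] d[OF t] d[OF smooth_F[OF l]] d[OF smooth_on_const]
        mat_wirtinger_F[OF assms(1) l] mat_wirtinger_F[OF assms] mat_wirtinger_transpose assms l)
  also have "\<dots> = F z (eps * l) ** (maurer c F (eps * l) z ** P_mat + P_mat ** transpose (maurer c F l z))
      ** transpose (F z l)"
    by (simp add: matrix_transpose_mul matrix_mul_assoc matrix_add_ldistrib matrix_add_rdistrib)
  finally have "F z (eps * l) ** ((maurer c F (eps * l) z ** P_mat + P_mat ** transpose (maurer c F l z))
      ** transpose (F z l)) = F z (eps * l) ** 0"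
    by (simp add: matrix_mul_assoc)
  then have 0: "(maurer c F (eps * l) z ** P_mat + P_mat ** transpose (maurer c F l z))
      ** transpose (F z l) = 0"
    by (rule matrix_mult_left_cancel[rotated]) (simp add: det_F[OF assms(1) l])
  let ?i = "matrix_inv (transpose (F z l))"
  have "transpose (F z l) ** ?i = mat 1"
    using det_F[OF assms] by (intro matrix_inv_cancel) simp
  then have "X = X ** transpose (F z l) ** ?i" for X :: mat3
    by (simp flip: matrix_mul_assoc)
  then show ?thesis using 0 by (metis matrix_mult_zero(2))
qed

text \<open>Differentiating \<open>tau_relation\<close> along cnj z, the entrywise conjugation turns
  this into the conjugate of a derivative along z. Thus the z-part determines the other
  part.\<close>

lemma maurer_tau:
  assumes "z \<in> D" "l \<noteq> 0"
  shows "maurer \<i> F l z = T_mat H ** map_matrix cnj (maurer (- \<i>) F (inverse (cnj l)) z) ** T_mat H"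
proof -
  let ?l = "inverse (cnj l)"
  let ?M = "map_matrix cnj (maurer (- \<i>) F ?l z)"
  have l: "?l \<noteq> 0" using assms by simp
  note d = smooth_on_differentiable[OF _ assms(1)]
  have c: "smooth_on D (\<lambda>z. map_matrix cnj (F z ?l))"
    using smooth_F[OF l] by (intro smooth_on_matrix[OF open_D])
      (simp add: smooth_on_vec_nth open_D smooth_on_bounded_linear[OF open_D bounded_linear_cnj])
  have FT: "smooth_on D (\<lambda>z. F z l ** T_mat H)"
    by (intro smooth_on_matrix_mult open_D smooth_F assms smooth_on_const)
  have "F z l ** (maurer \<i> F l z ** T_mat H) = mat_wirtinger \<i> (\<lambda>w. F w l ** T_mat H) z"
    by (simp add: mat_wirtinger_mult d[OF smooth_F] d[OF smooth_on_const] mat_wirtinger_F assms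
        matrix_mul_assoc)
  also have "\<dots> = mat_wirtinger \<i> (\<lambda>w. T_mat H ** map_matrix cnj (F w ?l)) z"
    by (rule mat_wirtinger_cong[OF open_D assms(1) d[OF FT]]) (simp add: tau_relation assms)
  also have "\<dots> = T_mat H ** map_matrix cnj (F z ?l) ** ?M"
    by (simp add: mat_wirtinger_mult d[OF c] d[OF smooth_F[OF l]] d[OF smooth_on_const]
        mat_wirtinger_F l mat_wirtinger_cnj map_matrix_cnj_mult matrix_mul_assoc assms(1)
        del: inverse_nonzero_iff_nonzero)
  also have "\<dots> = F z l ** (T_mat H ** ?M)"
    by (simp add: tau_relation assms matrix_mul_assoc)
  finally have "maurer \<i> F l z ** T_mat H = T_mat H ** ?M"
    by (rule matrix_mult_left_cancel[rotated]) (simp add: det_F assms)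
  then show ?thesis
    by (metis T_mat_involution[OF H] matrix_mul_assoc matrix_mul_rid)
qed

lemma maurer_flat:
  assumes "z \<in> D" "l \<noteq> 0"
  shows "mat_wirtinger \<i> (maurer (- \<i>) F l) z + maurer \<i> F l z ** maurer (- \<i>) F l z
    = mat_wirtinger (- \<i>) (maurer \<i> F l) z + maurer (- \<i>) F l z ** maurer \<i> F l z"
  by (rule maurer_cartan_flat[OF open_D assms(1) smooth_F[OF assms(2)]])
    (simp_all add: smooth_maurer assms det_F mat_wirtinger_F)

end

section \<open>Normalising the gauge\<close>

text \<open>\<open>s_const H\<close> is 1 or \<i>. The last identity absorbs the factor -H/2 that
  conjugation by \<open>T_mat H\<close> puts on the conjugated entries.\<close>

lemma s_const_facts:
  assumes "H = 2 \<or> H = - 2"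
  shows "s_const H \<noteq> 0" "norm (s_const H) = 1" "(s_const H)\<^sup>2 = of_real (- H / 2)"
    "of_real (- H / 2) * cnj (s_const H) = s_const H"
  using assms by (auto simp: s_const_def)

text \<open>The scalar content of flatness: \<open>a\<close>, \<open>b\<close>, \<open>c\<close>
  stand for the entries 13, 21, 11 of F^{-1} F_z at \<lambda> = 1, and the three differential
  equations are the same entries of the flatness equation.\<close>

locale structure_equations =
  fixes H :: real and D :: "complex set" and a b c :: "complex \<Rightarrow> complex"
  assumes H: "H = 2 \<or> H = - 2" and open_D: "open D"
    and smooth: "smooth_on D a" "smooth_on D b" "smooth_on D c"
    and a_nonzero: "\<And>z. z \<in> D \<Longrightarrow> a z \<noteq> 0"
    and a_zbar: "\<And>z. z \<in> D \<Longrightarrow> wirtinger \<i> a z = cnj (c z) * a z"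
    and b_zbar: "\<And>z. z \<in> D \<Longrightarrow> wirtinger \<i> b z = - 2 * cnj (c z) * b z"
    and c_zbar: "\<And>z. z \<in> D \<Longrightarrow> wirtinger \<i> c z + wirtinger (- \<i>) (\<lambda>w. cnj (c w)) z
        = of_real (- H / 2) * (a z * cnj (a z)) - b z * cnj (b z)"
begin

definition \<psi> :: "complex \<Rightarrow> real" where "\<psi> z = ln ((cmod (a z))\<^sup>2)"
text \<open>The gauged entry 21 is \<open>u z * u z * b z\<close> and has to equal U e^{-\<psi>}.
  With u = a / (s |a|) and |a|^2 = e^\<psi> this forces U = a^2 b / s^2, and s^2 = -H/2 is its own
  inverse.\<close>

definition U :: "complex \<Rightarrow> complex" where "U z = of_real (- H / 2) * (a z * a z * b z)"
lemma U_fun: "U = (\<lambda>z. of_real (- H / 2) * (a z * a z * b z))"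
  by (simp add: fun_eq_iff U_def)

text \<open>This is a / (s |a|); the modulus is written through \<psi> so that the rule for real
  exponentials differentiates it.\<close>

definition u :: "complex \<Rightarrow> complex" where
  "u z = a z * inverse (s_const H) * of_real (exp (- 1 / 2 * \<psi> z))"

lemma u_fun: "u = (\<lambda>z. a z * inverse (s_const H) * of_real (exp (- 1 / 2 * \<psi> z)))"
  by (simp add: fun_eq_iff u_def)

abbreviation \<Psi> :: "complex \<Rightarrow> complex \<Rightarrow> complex" where
  "\<Psi> k \<equiv> wirtinger k (\<lambda>w. of_real (\<psi> w))"

lemma diff: "z \<in> D \<Longrightarrow> a differentiable (at z)" "z \<in> D \<Longrightarrow> b differentiable (at z)"
    "z \<in> D \<Longrightarrow> c differentiable (at z)"
  using smooth smooth_on_differentiable by blast+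

lemma diff_cnj: "f differentiable (at z) \<Longrightarrow> (\<lambda>w. cnj (f w)) differentiable (at z)" for f :: "complex \<Rightarrow> complex"
  using bounded_linear.has_derivative[OF bounded_linear_cnj] unfolding differentiable_def by blast

lemma exp_\<psi>: "z \<in> D \<Longrightarrow> exp (\<psi> z) = (cmod (a z))\<^sup>2"
  using a_nonzero by (simp add: \<psi>_def)

lemma of_real_exp_\<psi>: "z \<in> D \<Longrightarrow> of_real (exp (\<psi> z)) = a z * cnj (a z)"
  using complex_norm_square[of "a z"] by (simp add: exp_\<psi>)

lemma smooth_\<psi>: "smooth_on D \<psi>"
proof -
  \<comment> \<open>The squared modulus is written as a polynomial in real and imaginary parts,
    which is visibly smooth.\<close>
  have "smooth_on D (\<lambda>z. Re (a z) * Re (a z) + Im (a z) * Im (a z))"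
    by (intro smooth_on_add smooth_on_mult smooth_on_bounded_linear[OF open_D bounded_linear_Re]
        smooth_on_bounded_linear[OF open_D bounded_linear_Im] open_D smooth)
  then have "smooth_on D (\<lambda>z. ln (Re (a z) * Re (a z) + Im (a z) * Im (a z)))"
    using a_nonzero
    by (intro smooth_on_ln open_D) (auto simp: complex_neq_0 power2_eq_square)
  then show ?thesis
    by (rule smooth_on_cong[OF open_D]) (simp add: \<psi>_def cmod_power2 flip: power2_eq_square)
qed

lemma smooth_of_real_\<psi>: "smooth_on D (\<lambda>z. complex_of_real (\<psi> z))"
  by (rule smooth_on_bounded_linear[OF open_D bounded_linear_of_real smooth_\<psi>])

text \<open>Differentiating e^\<psi> = a cnj a and dividing by it gives the logarithmic derivative
  of |a|^2 without choosing a branch of log a.\<close>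

lemma \<Psi>_eq:
  assumes "z \<in> D"
  shows "\<Psi> k z = wirtinger k a z / a z + cnj (wirtinger (cnj k) a z / a z)"
proof -
  have "of_real (exp (\<psi> z)) * \<Psi> k z = wirtinger k (\<lambda>w. of_real (exp (1 * \<psi> w))) z"
    using wirtinger_of_real_exp[OF smooth_on_differentiable[OF smooth_\<psi> assms], of k 1] by simp
  also have "\<dots> = wirtinger k (\<lambda>w. a w * cnj (a w)) z"
    by (rule wirtinger_cong[OF open_D assms, symmetric])
      (use of_real_exp_\<psi> in \<open>auto intro!: differentiable_mult diff_cnj diff assms\<close>)
  also have "\<dots> = wirtinger k a z * cnj (a z) + a z * cnj (wirtinger (cnj k) a z)"
    by (simp add: wirtinger_mult wirtinger_cnj diff diff_cnj assms)
  finally show ?thesis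
    using a_nonzero[OF assms] by (simp add: of_real_exp_\<psi> assms field_simps)
qed

lemma \<Psi>_z: "z \<in> D \<Longrightarrow> \<Psi> (- \<i>) z = wirtinger (- \<i>) a z / a z + c z"
  using a_nonzero by (simp add: \<Psi>_eq a_zbar)

text \<open>Differentiate \<psi>_z a = a_z + c a along cnj z, exchange the derivatives of
  \<open>a\<close>, and insert \<open>a_zbar\<close>. All terms cancel except those of
  \<open>c_zbar\<close> times \<open>a\<close>, and \<open>a\<close> is nonzero.\<close>

lemma \<psi>_z_zbar:
  assumes z: "z \<in> D"
  shows "wirtinger \<i> (\<Psi> (- \<i>)) z = of_real (- H / 2) * (a z * cnj (a z)) - b z * cnj (b z)"
proof -
  note d = smooth_on_differentiable[OF _ z]
  note s\<psi> = smooth_on_wirtinger[OF open_D smooth_of_real_\<psi>, of "- \<i>"]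
    and sa = smooth_on_wirtinger[OF open_D smooth(1)]
  have \<Psi>_a: "\<Psi> (- \<i>) z * a z = wirtinger (- \<i>) a z + c z * a z"
    using a_nonzero[OF z] by (simp add: \<Psi>_z z field_simps)
  have "wirtinger \<i> (\<Psi> (- \<i>)) z * a z + \<Psi> (- \<i>) z * (cnj (c z) * a z)
      = wirtinger \<i> (\<lambda>w. \<Psi> (- \<i>) w * a w) z"
    by (simp add: wirtinger_mult d s\<psi> diff z a_zbar)
  also have "\<dots> = wirtinger \<i> (\<lambda>w. wirtinger (- \<i>) a w + c w * a w) z"
    using a_nonzero
    by (intro wirtinger_cong[OF open_D z] d smooth_on_mult s\<psi> smooth open_D)
      (simp add: \<Psi>_z field_simps)
  also have "\<dots> = wirtinger \<i> (wirtinger (- \<i>) a) z + wirtinger \<i> c z * a z + c z * (cnj (c z) * a z)"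
    by (simp add: wirtinger_add wirtinger_mult d sa diff z a_zbar differentiable_mult)
  also have "wirtinger \<i> (wirtinger (- \<i>) a) z = wirtinger (- \<i>) (wirtinger \<i> a) z"
    by (rule wirtinger_commute[OF open_D z smooth(1)])
  also have "\<dots> = wirtinger (- \<i>) (\<lambda>w. cnj (c w) * a w) z"
    by (rule wirtinger_cong[OF open_D z d[OF sa] a_zbar])
  also have "\<dots> = wirtinger (- \<i>) (\<lambda>w. cnj (c w)) z * a z + cnj (c z) * wirtinger (- \<i>) a z"
    by (simp add: wirtinger_mult diff diff_cnj z)
  finally have "wirtinger \<i> (\<Psi> (- \<i>)) z * a z
      = (wirtinger \<i> c z + wirtinger (- \<i>) (\<lambda>w. cnj (c w)) z) * a z"
    using \<Psi>_a by algebra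
  then show ?thesis using a_nonzero[OF z] c_zbar[OF z] by simp
qed

text \<open>The logarithmic derivatives along cnj z cancel: each factor \<open>a\<close> contributes
  cnj c and \<open>b\<close> contributes -2 cnj c.\<close>

lemma U_zbar:
  assumes z: "z \<in> D"
  shows "wirtinger \<i> U z = 0"
  unfolding U_fun
  by (simp only: wirtinger_mult wirtinger_const diff z differentiable_mult differentiable_const
      a_zbar b_zbar) (simp add: algebra_simps)

lemma norm_U:
  assumes "z \<in> D"
  shows "(cmod (U z))\<^sup>2 * exp (- 2 * \<psi> z) = (cmod (b z))\<^sup>2"
proof -
  have "exp (- 2 * \<psi> z) = inverse (exp (\<psi> z) ^ 2)"
    by (simp add: exp_minus exp_double)
  moreover have "(H / 2)\<^sup>2 = 1" using H by auto
  then have "(cmod (U z))\<^sup>2 = (exp (\<psi> z))\<^sup>2 * (cmod (b z))\<^sup>2"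
    by (simp add: U_def norm_mult exp_\<psi> assms power_mult_distrib norm_divide power_divide)
  ultimately show ?thesis by simp
qed

lemma gauss_codazzi: "gauss_codazzi H D \<psi> U"
  unfolding gauss_codazzi_def d_z_eq_wirtinger d_zbar_eq_wirtinger
proof (intro conjI ballI)
  show "smooth_on D \<psi>" by (rule smooth_\<psi>)
  have "smooth_on D (\<lambda>z. of_real (- H / 2) * (a z * a z * b z))"
    by (intro smooth_on_mult open_D smooth_on_const smooth)
  then show "smooth_on D U" unfolding U_fun .
  fix z assume z: "z \<in> D"
  show "wirtinger \<i> U z = 0" by (rule U_zbar[OF z])
  have "complex_of_real ((cmod (b z))\<^sup>2) = b z * cnj (b z)" by (simp only: complex_norm_square)
  then show "wirtinger \<i> (\<Psi> (- \<i>)) z + of_real (H / 2 * exp (\<psi> z))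
      + of_real ((cmod (U z))\<^sup>2 * exp (- 2 * \<psi> z)) = 0"
    unfolding norm_U[OF z] \<psi>_z_zbar[OF z] of_real_mult of_real_exp_\<psi>[OF z]
    by (simp add: field_simps)
qed

lemma exp_half_\<psi>: "z \<in> D \<Longrightarrow> exp (\<psi> z / 2) = cmod (a z)"
proof -
  assume z: "z \<in> D"
  have "(exp (\<psi> z / 2))\<^sup>2 = (cmod (a z))\<^sup>2"
    using exp_\<psi>[OF z] by (simp flip: exp_double)
  then show ?thesis by (simp add: power2_eq_iff_nonneg)
qed

lemma norm_u: "z \<in> D \<Longrightarrow> cmod (u z) = 1"
  using exp_half_\<psi>[of z] a_nonzero[of z] s_const_facts[OF H]
  by (simp add: u_def norm_mult norm_inverse exp_minus)

lemma is_gauge: "is_gauge D u"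
proof -
  have "smooth_on D (\<lambda>z. complex_of_real (exp (- 1 / 2 * \<psi> z)))"
    by (intro smooth_on_bounded_linear[OF open_D bounded_linear_of_real] smooth_on_exp smooth_on_mult
        smooth_on_const smooth_\<psi> open_D)
  then have "smooth_on D (\<lambda>z. a z * inverse (s_const H) * of_real (exp (- 1 / 2 * \<psi> z)))"
    by (intro smooth_on_mult smooth_on_const smooth open_D)
  then have "smooth_on D u" unfolding u_fun .
  then show ?thesis by (simp add: is_gauge_def norm_u)
qed

lemma wirtinger_u:
  assumes z: "z \<in> D"
  shows "wirtinger k u z = u z * (wirtinger k a z / a z - \<Psi> k z / 2)"
proof -
  have e: "(\<lambda>w. complex_of_real (exp (- 1 / 2 * \<psi> w))) differentiable (at z)"
    by (intro smooth_on_differentiable[OF _ z] smooth_on_bounded_linear[OF open_D bounded_linear_of_real]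
        smooth_on_exp smooth_on_mult smooth_on_const smooth_\<psi> open_D)
  show ?thesis
    unfolding u_fun
    using a_nonzero[OF z]
    by (simp only: wirtinger_mult wirtinger_const diff z differentiable_mult differentiable_const e
        wirtinger_of_real_exp smooth_on_differentiable[OF smooth_\<psi> z])
      (simp add: field_simps s_const_facts[OF H])
qed

text \<open>Gauging adds u^{-1} u_z to the diagonal entry c, so exactly \<psi>_z / 2 remains, as in
  \<open>alpha\<close>; \<open>u_zbar\<close> does the same for -cnj c.\<close>

lemma u_z: "z \<in> D \<Longrightarrow> wirtinger (- \<i>) u z = u z * (\<Psi> (- \<i>) z / 2 - c z)"
  by (simp add: wirtinger_u \<Psi>_z field_simps)

lemma u_zbar: "z \<in> D \<Longrightarrow> wirtinger \<i> u z = u z * (cnj (c z) - \<Psi> \<i> z / 2)"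
  using a_nonzero by (simp add: wirtinger_u a_zbar)

lemma a_eq: "z \<in> D \<Longrightarrow> a z = u z * s_const H * of_real (exp (\<psi> z / 2))"
proof -
  assume z: "z \<in> D"
  have "complex_of_real (exp (- 1 / 2 * \<psi> z)) * of_real (exp (\<psi> z / 2)) = 1"
    by (simp flip: of_real_mult exp_add)
  moreover have "inverse (s_const H) * s_const H = 1" using s_const_facts[OF H] by simp
  ultimately show ?thesis unfolding u_def by algebra
qed

text \<open>Since \<open>u\<close> is unimodular it cancels the phase of cnj a, and -H/2 times cnj s
  is s again. This is the normalised entry of the cnj z-part.\<close>

lemma cnj_a_eq:
  assumes z: "z \<in> D"
  shows "u z * (of_real (- H / 2) * cnj (a z)) = s_const H * of_real (exp (\<psi> z / 2))"
proof -
  have "u z * cnj (u z) = 1" using norm_u[OF z] complex_norm_square[of "u z"] by simp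
  then have "u z * (of_real (- H / 2) * cnj (a z))
      = (of_real (- H / 2) * cnj (s_const H)) * of_real (exp (\<psi> z / 2))"
    by (subst a_eq[OF z]) (simp add: algebra_simps)
  then show ?thesis by (simp only: s_const_facts[OF H])
qed

lemma U_eq:
  assumes z: "z \<in> D"
  shows "U z * of_real (exp (- \<psi> z)) = u z * u z * b z"
proof -
  let ?e = "complex_of_real (exp (\<psi> z / 2))"
  have "U z = (of_real (- H / 2) * (s_const H)\<^sup>2) * (u z * u z * b z * (?e * ?e))"
    unfolding U_def by (subst (1 2) a_eq[OF z]) (simp add: power2_eq_square algebra_simps)
  also have "of_real (- H / 2) * (s_const H)\<^sup>2 = 1"
    unfolding s_const_facts[OF H] using H by auto
  also have "?e * ?e = of_real (exp (\<psi> z))" by (simp flip: of_real_mult exp_add)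
  finally show ?thesis by (simp flip: of_real_mult exp_add)
qed

end

section \<open>Gauge transformations\<close>

lemma gauge_mat_mult: "gauge_mat x ** gauge_mat y = gauge_mat (x * y)"
  by (simp add: mat3_eq_simps gauge_mat_def)

lemma gauge_mat_1: "gauge_mat 1 = mat 1"
  by (simp add: mat3_eq_simps gauge_mat_def)

lemma gauge_mat_inverse:
  "x \<noteq> 0 \<Longrightarrow> gauge_mat x ** gauge_mat (inverse x) = mat 1"
  "x \<noteq> 0 \<Longrightarrow> gauge_mat (inverse x) ** gauge_mat x = mat 1"
  by (simp_all add: gauge_mat_mult gauge_mat_1)

lemma det_gauge_mat: "x \<noteq> 0 \<Longrightarrow> det (gauge_mat x) = 1"
  by (simp add: det_3 gauge_mat_def)

lemma smooth_on_gauge_mat: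
  assumes "open S" "smooth_on S f" "\<And>x. x \<in> S \<Longrightarrow> f x \<noteq> 0"
  shows "smooth_on S (\<lambda>x. gauge_mat (f x))"
proof (rule smooth_on_matrix[OF assms(1)])
  show "smooth_on S (\<lambda>x. gauge_mat (f x) $ i $ j)" for i j
    using exhaust_3[of i] exhaust_3[of j]
    by (auto simp: gauge_mat_def smooth_on_const assms smooth_on_inverse)
qed

lemma mat_wirtinger_gauge_mat:
  assumes "f differentiable (at z)" "f z \<noteq> 0"
  shows "mat_wirtinger k (\<lambda>w. gauge_mat (f w)) z
    = vector [vector [wirtinger k f z, 0, 0], vector [0, - wirtinger k f z / (f z)\<^sup>2, 0], vector [0, 0, 0]]"
  by (simp add: vec_eq_iff forall_3 gauge_mat_def wirtinger_inverse[OF assms])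

context twisted_frame
begin

text \<open>The product rule for F k gives the usual transformation k^{-1} M k + k^{-1} dk of a
  connection form.\<close>

lemma maurer_gauged:
  assumes u: "is_gauge D u" and z: "z \<in> D" and l: "l \<noteq> 0"
  shows "maurer k (gauged F u) l z = gauge_mat (inverse (u z)) ** (maurer k F l z ** gauge_mat (u z)
      + mat_wirtinger k (\<lambda>w. gauge_mat (u w)) z)"
proof -
  have nz: "w \<in> D \<Longrightarrow> u w \<noteq> 0" for w using u by (auto simp: is_gauge_def)
  have su: "smooth_on D (\<lambda>w. gauge_mat (u w))"
    using u nz by (intro smooth_on_gauge_mat open_D) (auto simp: is_gauge_def)
  have "F z l ** gauge_mat (u z) ** (gauge_mat (inverse (u z)) ** matrix_inv (F z l))
      = F z l ** (gauge_mat (u z) ** gauge_mat (inverse (u z))) ** matrix_inv (F z l)"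
    by (simp add: matrix_mul_assoc)
  also have "\<dots> = mat 1"
    using nz[OF z] by (simp add: gauge_mat_inverse matrix_inv_cancel det_F z l)
  finally have inv: "matrix_inv (gauged F u z l) = gauge_mat (inverse (u z)) ** matrix_inv (F z l)"
    unfolding gauged_def by (rule matrix_inv_eqI)
  have "matrix_inv (F z l) ** F z l = mat 1" by (simp add: matrix_inv_cancel det_F z l)
  then have id: "X ** matrix_inv (F z l) ** F z l = X" for X :: mat3
    by (simp flip: matrix_mul_assoc)
  show ?thesis
    unfolding maurer_def inv
    unfolding gauged_def
    by (simp add: mat_wirtinger_mult differentiable_F z l smooth_on_differentiable[OF su]
        matrix_add_ldistrib matrix_mul_assoc id)
qed

lemma smooth_loop_map_gauged:
  assumes u: "is_gauge D u"
  shows "smooth_loop_map H D (gauged F u)"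
  unfolding smooth_loop_map_def
proof (intro conjI ballI)
  have nz: "w \<in> D \<Longrightarrow> u w \<noteq> 0" for w using u by (auto simp: is_gauge_def)
  let ?S = "D \<times> (- {0 :: complex})"
  have S: "open ?S" using open_D by (intro open_Times) auto
  \<comment> \<open>The projection to \<open>z\<close>, written with the translation 0 to fit the
    affine composition rule.\<close>
  have "smooth_on ?S (\<lambda>p. u (0 + fst p))"
    using u by (intro smooth_on_compose_affine[OF open_D S bounded_linear_fst]) (auto simp: is_gauge_def)
  then have "smooth_on ?S (\<lambda>p. gauge_mat (u (fst p)))"
    using nz by (intro smooth_on_gauge_mat S) auto
  then have "smooth_on ?S (\<lambda>p. (case p of (z, l) \<Rightarrow> F z l) ** gauge_mat (u (fst p)))"
    using F by (intro smooth_on_matrix_mult S) (auto simp: smooth_loop_map_def)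
  then show "smooth_on ?S (\<lambda>(z, l). gauged F u z l)"
    by (rule smooth_on_cong[OF S]) (auto simp: gauged_def)
  fix z assume z: "z \<in> D"
  \<comment> \<open>Unimodularity makes the gauge matrix a fixed point of
    \<open>tau\<close>.\<close>
  have uc: "cnj (u z) = inverse (u z)"
    using u z complex_norm_square[of "u z"] nz[OF z]
    by (simp add: is_gauge_def field_simps)
  show "gauged F u z \<in> twisted_loop_group H"
    unfolding twisted_loop_group_def
  proof (intro CollectI conjI allI impI)
    fix l :: complex assume l: "l \<noteq> 0"
    show det: "det (gauged F u z l) = 1"
      using l z nz by (simp add: gauged_def det_mul det_F det_gauge_mat)
    show "tau H (gauged F u z (inverse (cnj l))) = gauged F u z l"
    proof -
      have "T_mat H ** map_matrix cnj (gauge_mat (u z)) = gauge_mat (u z) ** T_mat H"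
        by (simp add: mat3_eq_simps gauge_mat_def T_mat_def uc)
      then have "T_mat H ** map_matrix cnj (gauged F u z (inverse (cnj l))) = gauged F u z l ** T_mat H"
        using tau_relation[OF z l]
        by (simp add: gauged_def map_matrix_cnj_mult matrix_mul_assoc) (simp flip: matrix_mul_assoc)
      then show ?thesis by (simp add: tau_eq_iff[OF H])
    qed
    \<comment> \<open>\<open>P_mat\<close> pairs the first two diagonal entries, whose product is 1;
      this is invariance under \<open>sigma\<close>.\<close>
    have P: "gauge_mat (u z) ** P_mat ** transpose (gauge_mat (u z)) = P_mat"
      using nz[OF z] by (simp add: mat3_eq_simps gauge_mat_def P_mat_def)
    have "gauged F u z (eps * l) ** P_mat ** transpose (gauged F u z l)
        = F z (eps * l) ** (gauge_mat (u z) ** P_mat ** transpose (gauge_mat (u z))) ** transpose (F z l)"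
      by (simp add: gauged_def matrix_transpose_mul matrix_mul_assoc)
    also have "\<dots> = P_mat" unfolding P by (rule sigma_relation[OF z l])
    finally show "sigma (gauged F u z l) = gauged F u z (eps * l)"
      using det by (simp add: sigma_eq_iff)
  next
    fix i j
    have "(\<lambda>l. F z l $ i $ k) holomorphic_on (- {0})" for k
      using loop[OF z] by (simp add: twisted_loop_group_def)
    then show "(\<lambda>l. gauged F u z l $ i $ j) holomorphic_on (- {0})"
      unfolding gauged_def matrix_matrix_mult_def
      by (simp add: sum_3) (intro holomorphic_intros)
  qed
qed

end

section \<open>Normal form of the Maurer-Cartan form\<close>

lemma map_matrix_mult_left: "map_matrix ((*) (l :: complex)) X ** Y = map_matrix ((*) l) (X ** Y)"
    "Y ** map_matrix ((*) l) X = map_matrix ((*) l) (Y ** X)"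
  by (simp_all add: vec_eq_iff matrix_matrix_mult_def sum_distrib_left mult.assoc mult.left_commute)

text \<open>With k the gauge matrix, entry ij is scaled by k_j / k_i, while the derivative of k only
  shifts the first two diagonal entries, in opposite directions.\<close>

lemma gauge_conjugate:
  assumes "x \<noteq> 0"
  shows "gauge_mat (inverse x) ** (X ** gauge_mat x
      + vector [vector [d, 0, 0], vector [0, - d / x\<^sup>2, 0], vector [0, 0, 0]])
    = vector [vector [X $ 1 $ 1 + inverse x * d, inverse x * inverse x * X $ 1 $ 2, inverse x * X $ 1 $ 3],
        vector [x * x * X $ 2 $ 1, X $ 2 $ 2 - inverse x * d, x * X $ 2 $ 3],
        vector [x * X $ 3 $ 1, inverse x * X $ 3 $ 2, X $ 3 $ 3]]"
  using assms by (simp add: mat3_eq_simps gauge_mat_def field_simps power2_eq_square)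

context twisted_frame
begin

context
  fixes A B :: "complex \<Rightarrow> mat3"
  assumes lin: "linear_in_loop_parameter D F A B" and A13: "\<And>z. z \<in> D \<Longrightarrow> A z $ 1 $ 3 \<noteq> 0"
begin

text \<open>The entries are read from \<open>maurer\<close> at \<lambda> = 1 because it is known to
  be smooth, whereas \<open>A\<close> and \<open>B\<close> are arbitrary functions; by twisting, the
  entries 13 and 21 come from \<open>A\<close> alone and 11 from \<open>B\<close> alone.\<close>

definition "a z = maurer (- \<i>) F 1 z $ 1 $ 3"
definition "b z = maurer (- \<i>) F 1 z $ 2 $ 1"
definition "c z = maurer (- \<i>) F 1 z $ 1 $ 1"

lemma maurer_linear: "z \<in> D \<Longrightarrow> l \<noteq> 0 \<Longrightarrow> maurer (- \<i>) F l z = map_matrix ((*) l) (A z) + B z"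
  using lin by (simp add: linear_in_loop_parameter_def mc_z_eq_maurer)

lemma twisted_A:
  assumes z: "z \<in> D"
  shows "map_matrix ((*) eps) (A z) ** P_mat + P_mat ** transpose (A z) = 0"
    and "B z ** P_mat + P_mat ** transpose (B z) = 0"
proof -
  let ?X = "map_matrix ((*) eps) (A z) ** P_mat + P_mat ** transpose (A z)"
  let ?Y = "B z ** P_mat + P_mat ** transpose (B z)"
  have *: "map_matrix ((*) l) ?X + ?Y = 0" if "l \<noteq> 0" for l
  proof -
    have "map_matrix ((*) l) ?X + ?Y = (map_matrix ((*) (eps * l)) (A z) + B z) ** P_mat
        + P_mat ** transpose (map_matrix ((*) l) (A z) + B z)"
      by (simp add: vec_eq_iff matrix_matrix_mult_def transpose_def sum.distrib
          sum_distrib_left algebra_simps)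
    also have "\<dots> = 0"
      using maurer_sigma[OF z that, of "- \<i>"] that eps_nonzero by (simp add: maurer_linear z)
    finally show ?thesis .
  qed
  \<comment> \<open>A relation linear in \<open>l\<close> that holds at \<open>l = 1\<close> and
    \<open>l = -1\<close> separates into its two coefficients.\<close>
  have "x = 0 \<and> y = 0" if "1 * x + y = 0" "-1 * x + y = 0" for x y :: complex
    using that by (simp add: add_eq_0_iff2)
  moreover have "1 * ?X $ i $ j + ?Y $ i $ j = 0" "-1 * ?X $ i $ j + ?Y $ i $ j = 0" for i j
    using *[of 1] *[of "-1"] by (simp_all only: vec_eq_iff vector_add_component nth_map_matrix zero_index) auto
  ultimately have "?X $ i $ j = 0" "?Y $ i $ j = 0" for i j by blast+
  then show "?X = 0" "?Y = 0" by (simp_all add: vec_eq_iff)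
qed

lemma maurer_z:
  assumes z: "z \<in> D" and l: "l \<noteq> 0"
  shows "maurer (- \<i>) F l z = vector [vector [c z, 0, l * a z], vector [l * b z, - c z, 0], vector [0, l * a z, 0]]"
  using twisted_entries_eps[OF twisted_A(1)[OF z]] twisted_entries_1[OF twisted_A(2)[OF z]]
  by (simp add: vec_eq_iff forall_3 maurer_linear z l a_def b_def c_def)

text \<open>Conjugation by \<open>T_mat H\<close> swaps the indices 1 and 2 and multiplies entries
  with exactly one index 3 by -H/2; the conjugate of \<open>inverse (cnj l)\<close> is
  \<open>inverse l\<close>.\<close>

lemma maurer_zbar:
  assumes z: "z \<in> D" and l: "l \<noteq> 0"
  shows "maurer \<i> F l z = vector [vector [- cnj (c z), inverse l * cnj (b z), 0],
      vector [0, cnj (c z), of_real (- H / 2) * (inverse l * cnj (a z))],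
      vector [of_real (- H / 2) * (inverse l * cnj (a z)), 0, 0]]"
proof -
  have "inverse (cnj l) \<noteq> 0" using l by simp
  then show ?thesis
    unfolding maurer_tau[OF z l] maurer_z[OF z \<open>inverse (cnj l) \<noteq> 0\<close>]
    by (simp add: mat3_eq_simps T_mat_def)
qed

lemma smooth_entries: "smooth_on D a" "smooth_on D b" "smooth_on D c"
  using smooth_maurer[of 1 "- \<i>"]
  by (simp_all add: a_def[abs_def] b_def[abs_def] c_def[abs_def] smooth_on_vec_nth open_D)

lemma structure_equations: "structure_equations H D a b c"
proof
  fix z assume z: "z \<in> D"
  show "a z \<noteq> 0"
    using A13[OF z] twisted_entries_1[OF twisted_A(2)[OF z]] by (simp add: a_def maurer_linear z)
  have flat: "wirtinger \<i> (\<lambda>w. maurer (- \<i>) F 1 w $ i $ j) z + (maurer \<i> F 1 z ** maurer (- \<i>) F 1 z) $ i $ j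
      = wirtinger (- \<i>) (\<lambda>w. maurer \<i> F 1 w $ i $ j) z + (maurer (- \<i>) F 1 z ** maurer \<i> F 1 z) $ i $ j"
    for i j
    using arg_cong[OF maurer_flat[OF z, of 1], of "\<lambda>X. X $ i $ j"] by simp
  \<comment> \<open>The closed form of an entry may be inserted under the derivative because it
    holds throughout the open set \<open>D\<close>.\<close>
  have zbar: "wirtinger (- \<i>) (\<lambda>w. maurer \<i> F 1 w $ i $ j) z = wirtinger (- \<i>) g z"
    if "\<And>w. w \<in> D \<Longrightarrow> maurer \<i> F 1 w $ i $ j = g w" for i j g
    by (rule wirtinger_cong[OF open_D z _ that])
      (intro smooth_on_differentiable[OF _ z] smooth_on_vec_nth open_D smooth_maurer zero_neq_one[symmetric])
  note form = maurer_z[OF z, of 1, simplified] maurer_zbar[OF z, of 1, simplified]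
  have "wirtinger \<i> a z + (maurer \<i> F 1 z ** maurer (- \<i>) F 1 z) $ 1 $ 3
      = wirtinger (- \<i>) (\<lambda>w. 0) z + (maurer (- \<i>) F 1 z ** maurer \<i> F 1 z) $ 1 $ 3"
    using flat[of 1 3] zbar[of 1 3 "\<lambda>_. 0"] by (simp add: maurer_zbar a_def[abs_def])
  then show "wirtinger \<i> a z = cnj (c z) * a z"
    by (simp add: form matrix_matrix_mult_def sum_3)
  have "wirtinger \<i> b z + (maurer \<i> F 1 z ** maurer (- \<i>) F 1 z) $ 2 $ 1
      = wirtinger (- \<i>) (\<lambda>w. 0) z + (maurer (- \<i>) F 1 z ** maurer \<i> F 1 z) $ 2 $ 1"
    using flat[of 2 1] zbar[of 2 1 "\<lambda>_. 0"] by (simp add: maurer_zbar b_def[abs_def])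
  then show "wirtinger \<i> b z = - 2 * cnj (c z) * b z"
    by (simp add: form matrix_matrix_mult_def sum_3 algebra_simps eq_neg_iff_add_eq_0)
  \<comment> \<open>Entry 11 is the only one of the three where the cnj z-part contributes a
    derivative, that of -cnj c.\<close>
  have "wirtinger \<i> c z + (maurer \<i> F 1 z ** maurer (- \<i>) F 1 z) $ 1 $ 1
      = wirtinger (- \<i>) (\<lambda>w. -1 * cnj (c w)) z + (maurer (- \<i>) F 1 z ** maurer \<i> F 1 z) $ 1 $ 1"
    using flat[of 1 1] zbar[of 1 1 "\<lambda>w. -1 * cnj (c w)"] by (simp add: maurer_zbar c_def[abs_def])
  moreover have "wirtinger (- \<i>) (\<lambda>w. -1 * cnj (c w)) z = - wirtinger (- \<i>) (\<lambda>w. cnj (c w)) z"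
    using wirtinger_mult[OF differentiable_const smooth_on_differentiable[OF
        smooth_on_bounded_linear[OF open_D bounded_linear_cnj smooth_entries(3)] z], of "- \<i>" "-1"]
    by simp
  moreover have "(maurer \<i> F 1 z ** maurer (- \<i>) F 1 z) $ 1 $ 1 = - (c z * cnj (c z)) + b z * cnj (b z)"
    "(maurer (- \<i>) F 1 z ** maurer \<i> F 1 z) $ 1 $ 1
      = - (c z * cnj (c z)) + of_real (- H / 2) * (a z * cnj (a z))"
    by (simp_all add: form matrix_matrix_mult_def sum_3)
  ultimately show "wirtinger \<i> c z + wirtinger (- \<i>) (\<lambda>w. cnj (c w)) z
      = of_real (- H / 2) * (a z * cnj (a z)) - b z * cnj (b z)"
    by algebra
qed (use H open_D smooth_entries in auto)

interpretation structure_equations H D a b c by (rule structure_equations)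

lemma mc_form_normalised:
  assumes z: "z \<in> D" and l: "l \<noteq> 0"
  shows "mc_form (gauged F u) l z v = alpha H \<psi> U l z v"
proof -
  have u: "u z \<noteq> 0" using norm_u[OF z] by auto
  have uc: "inverse (u z) = cnj (u z)"
    using norm_u[OF z] complex_norm_square[of "u z"] u by (simp add: field_simps)
  have du: "u differentiable (at z)"
    using is_gauge z by (auto simp: is_gauge_def intro: smooth_on_differentiable)
  \<comment> \<open>The gauged map is again differentiable in \<open>z\<close>, which allows its
    form to be split into the dz and d(cnj z) parts computed next.\<close>
  interpret G: twisted_frame H D "gauged F u"
    by unfold_locales (simp_all add: H open_D smooth_loop_map_gauged is_gauge)
  let ?e = "complex_of_real (exp (\<psi> z / 2))" and ?s = "s_const H"
  have a: "inverse (u z) * a z = ?s * ?e" using u a_eq[OF z] by simp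
  note ca = cnj_a_eq[OF z]
  have U: "u z * u z * b z = U z * of_real (exp (- \<psi> z))" by (simp only: U_eq[OF z])
  have cU: "inverse (u z) * inverse (u z) * cnj (b z) = cnj (U z) * of_real (exp (- \<psi> z))"
    using arg_cong[OF U, of cnj] by (simp add: uc)
  have cancel: "inverse (u z) * (u z * x) = x" for x using u by simp
  \<comment> \<open>Conjugation multiplies the entries 13 and 32 by u^{-1} and entry 21 by u^2,
    which normalises them by \<open>a_eq\<close> and \<open>U_eq\<close>; the diagonal comes from
    \<open>u_z\<close>.\<close>
  have z_form: "maurer (- \<i>) (gauged F u) l z = vector [vector [\<Psi> (- \<i>) z / 2, 0, ?s * l * ?e],
      vector [l * U z * of_real (exp (- \<psi> z)), - \<Psi> (- \<i>) z / 2, 0], vector [0, ?s * l * ?e, 0]]"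
  proof -
    have "inverse (u z) * (l * a z) = ?s * l * ?e" using a by algebra
    moreover have "u z * u z * (l * b z) = l * U z * of_real (exp (- \<psi> z))" using U by algebra
    ultimately show ?thesis
      unfolding maurer_gauged[OF is_gauge z l] mat_wirtinger_gauge_mat[OF du u] maurer_z[OF z l]
        u_z[OF z] gauge_conjugate[OF u] vector_3
      using cancel by (simp only: vec_eq_iff forall_3 vector_3) (simp add: field_simps)
  qed
  have zbar_form: "maurer \<i> (gauged F u) l z = vector [
      vector [- \<Psi> \<i> z / 2, inverse l * cnj (U z) * of_real (exp (- \<psi> z)), 0],
      vector [0, \<Psi> \<i> z / 2, ?s * inverse l * ?e], vector [?s * inverse l * ?e, 0, 0]]"
  proof -
    have "u z * (of_real (- H / 2) * (inverse l * cnj (a z))) = ?s * inverse l * ?e" using ca by algebra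
    moreover have "inverse (u z) * inverse (u z) * (inverse l * cnj (b z))
        = inverse l * cnj (U z) * of_real (exp (- \<psi> z))" using cU by algebra
    ultimately show ?thesis
      unfolding maurer_gauged[OF is_gauge z l] mat_wirtinger_gauge_mat[OF du u] maurer_zbar[OF z l]
        u_zbar[OF z] gauge_conjugate[OF u] vector_3
      using cancel by (simp only: vec_eq_iff forall_3 vector_3) (simp add: field_simps)
  qed
  show ?thesis
    unfolding mc_form_eq_maurer[where F = "gauged F u", OF G.differentiable_F[OF z l]] z_form zbar_form
    by (simp add: vec_eq_iff forall_3 alpha_def Let_def d_z_eq_wirtinger d_zbar_eq_wirtinger
        diff_divide_distrib algebra_simps)
qed

lemma gauge_to_extended_frame:
  "\<exists>u psi U. is_gauge D u \<and> gauss_codazzi H D psi U \<and>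
    (\<forall>z\<in>D. \<forall>l. l \<noteq> 0 \<longrightarrow> (\<forall>v. mc_form (gauged F u) l z v = alpha H psi U l z v))"
  using is_gauge gauss_codazzi mc_form_normalised by blast

end

text \<open>The dz-part of \<open>alpha\<close> is visibly linear in \<lambda>. Undoing a gauge
  independent of \<lambda> preserves linearity and multiplies entry 13 by the unit \<open>u\<close>,
  so it stays nonzero.\<close>

lemma primitive_harmonic_of_extended_frame:
  assumes u: "is_gauge D u" and ext: "extended_frame H D (gauged F u)"
  shows "primitive_harmonic_nondegenerate D F"
proof -
  from ext obtain psi U where G: "smooth_loop_map H D (gauged F u)"
    and mc: "\<And>z l v. z \<in> D \<Longrightarrow> l \<noteq> 0 \<Longrightarrow> mc_form (gauged F u) l z v = alpha H psi U l z v"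
    by (auto simp: extended_frame_def)
  interpret G: twisted_frame H D "gauged F u"
    by unfold_locales (simp_all add: H open_D G)
  define e p q where "e z = s_const H * of_real (exp (psi z / 2))"
    and "p z = d_z (\<lambda>w. of_real (psi w)) z / 2" and "q z = U z * of_real (exp (- psi z))" for z
  define A' B' :: "complex \<Rightarrow> mat3"
    where "A' z = vector [vector [0, 0, e z], vector [q z, 0, 0], vector [0, e z, 0]]"
      and "B' z = vector [vector [p z, 0, 0], vector [0, - p z, 0], vector [0, 0, 0]]" for z
  have M': "maurer (- \<i>) (gauged F u) l z = map_matrix ((*) l) (A' z) + B' z"
    if z: "z \<in> D" and l: "l \<noteq> 0" for z l
  proof -
    \<comment> \<open>The dz-coefficient of a form is recovered from its values on the tangent
      vectors 1 and \<i>.\<close>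
    have "maurer (- \<i>) (gauged F u) l z $ i $ j
        = (mc_form (gauged F u) l z 1 $ i $ j - \<i> * mc_form (gauged F u) l z \<i> $ i $ j) / 2" for i j
      unfolding mc_form_eq_maurer[where F = "gauged F u", OF G.differentiable_F[OF z l]] by (simp add: algebra_simps)
    note entry = this[unfolded mc[OF z l]]
    show ?thesis
      unfolding vec_eq_iff forall_3 entry
      by (simp add: alpha_def Let_def A'_def B'_def e_def p_def q_def) (simp add: field_simps)
  qed
  define K where "K z = mat_wirtinger (- \<i>) (\<lambda>w. gauge_mat (u w)) z" for z
  \<comment> \<open>These solve the gauge rule for the original form: M = (k M' - k_z) k^{-1}, where
    only M' involves \<lambda>.\<close>
  define A B where "A z = gauge_mat (u z) ** A' z ** gauge_mat (inverse (u z))"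
    and "B z = (gauge_mat (u z) ** B' z - K z) ** gauge_mat (inverse (u z))" for z
  have nz: "u z \<noteq> 0" if "z \<in> D" for z using u that by (auto simp: is_gauge_def)
  have "maurer (- \<i>) F l z = map_matrix ((*) l) (A z) + B z" if z: "z \<in> D" and l: "l \<noteq> 0" for z l
  proof -
    have "gauge_mat (u z) ** maurer (- \<i>) (gauged F u) l z = maurer (- \<i>) F l z ** gauge_mat (u z) + K z"
      using nz[OF z] by (simp add: maurer_gauged[OF u z l] K_def matrix_mul_assoc gauge_mat_inverse)
    then have "maurer (- \<i>) F l z ** gauge_mat (u z) = gauge_mat (u z) ** (map_matrix ((*) l) (A' z) + B' z) - K z"
      by (simp add: M' z l)
    then have "maurer (- \<i>) F l z ** gauge_mat (u z) ** gauge_mat (inverse (u z))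
        = (map_matrix ((*) l) (gauge_mat (u z) ** A' z) + (gauge_mat (u z) ** B' z - K z)) ** gauge_mat (inverse (u z))"
      by (simp add: matrix_add_ldistrib map_matrix_mult_left add_diff_eq)
    then show ?thesis
      using nz[OF z]
      by (simp add: matrix_add_rdistrib map_matrix_mult_left A_def B_def gauge_mat_inverse flip: matrix_mul_assoc)
  qed
  then have "linear_in_loop_parameter D F A B"
    by (simp add: linear_in_loop_parameter_def mc_z_eq_maurer)
  moreover have "A z $ 1 $ 3 \<noteq> 0" if "z \<in> D" for z
    using nz[OF that] s_const_facts(1)[OF H]
    by (simp add: A_def A'_def e_def gauge_mat_def matrix_matrix_mult_def sum_3)
  ultimately show ?thesis by (auto simp: primitive_harmonic_nondegenerate_def)
qed

end

theorem theorem3p2: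
  fixes H :: real
    and D :: "complex set"
    and F :: "complex \<Rightarrow> complex \<Rightarrow> complex^3^3"
  assumes H: "H = 2 \<or> H = - 2"
    and D: "is_domain D"
    and F: "smooth_loop_map H D F"
  shows "(\<forall>A B. linear_in_loop_parameter D F A B \<and> (\<forall>z\<in>D. A z $ 1 $ 3 \<noteq> 0) \<longrightarrow>
            (\<exists>u psi U. is_gauge D u \<and> gauss_codazzi H D psi U \<and>
               (\<forall>z\<in>D. \<forall>l. l \<noteq> 0 \<longrightarrow>
                  (\<forall>v. mc_form (gauged F u) l z v = alpha H psi U l z v)))) \<and>
         ((\<exists>u. is_gauge D u \<and> extended_frame H D (gauged F u)) \<longleftrightarrow>
            primitive_harmonic_nondegenerate D F)"
proof -
  interpret twisted_frame H D F
    using H D F by unfold_locales (auto simp: is_domain_def)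
  have forward: "\<exists>u psi U. is_gauge D u \<and> gauss_codazzi H D psi U \<and>
      (\<forall>z\<in>D. \<forall>l. l \<noteq> 0 \<longrightarrow> (\<forall>v. mc_form (gauged F u) l z v = alpha H psi U l z v))"
    if "linear_in_loop_parameter D F A B" "\<forall>z\<in>D. A z $ 1 $ 3 \<noteq> 0" for A B
    using gauge_to_extended_frame[OF that(1)] that(2) by blast
  have "\<exists>u. is_gauge D u \<and> extended_frame H D (gauged F u)" if "primitive_harmonic_nondegenerate D F"
  proof -
    from that obtain u psi U where "is_gauge D u" "gauss_codazzi H D psi U"
      "\<forall>z\<in>D. \<forall>l. l \<noteq> 0 \<longrightarrow> (\<forall>v. mc_form (gauged F u) l z v = alpha H psi U l z v)"
      using forward unfolding primitive_harmonic_nondegenerate_def by blast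
    \<comment> \<open>An extended frame must also take values in the twisted loop group, which the
      gauge preserves.\<close>
    then show ?thesis
      using smooth_loop_map_gauged unfolding extended_frame_def by blast
  qed
  then show ?thesis
    using forward primitive_harmonic_of_extended_frame by blast
qed

end
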